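(* Let inequality constraints be inactive at a W-stationary point $\bar x\in M$ of MPSC, i.e. $J_0(\bar x)=\emptyset$. Then $\bar x$ is nondegenerate if and only if it is strongly stable and satisfies LICQ.
   Context: Setting. Let $I,J$ be finite index sets, and let $f\in C^2(\mathbb{R}^n,\mathbb{R})$, $h\in C^2(\mathbb{R}^n,\mathbb{R}^{|I|})$, $g\in C^2(\mathbb{R}^n,\mathbb{R}^{|J|})$, $F_1,F_2\in C^2(\mathbb{R}^n,\mathbb{R}^k)$. The mathematical program with switching constraints MPSC$[f,h,g,F_1,F_2]$ is to minimize $f(x)$ subject to $x\in M$, where $M=\{x\in\mathbb{R}^n \mid h_i(x)=0\ (i\in I),\ g_j(x)\ge 0\ (j\in J),\ F_{1,m}(x)F_{2,m}(x)=0\ (m=1,\dots,k)\}$. Index sets at $\bar x\in M$: $J_0(\bar x)=\{j\in J\mid g_j(\bar x)=0\}$; $\alpha(\bar x)=\{m\mid F_{1,m}(\bar x)=0, F_{2,m}(\bar x)\ne 0\}$; $\beta(\bar x)=\{m\mid F_{1,m}(\bar x)=F_{2,m}(\bar x)=0\}$; $\gamma(\bar x)=\{m\mid F_{1,m}(\bar x)\ne 0, F_{2,m}(\bar x)=0\}$. LICQ holds at $\bar x\in M$ if the vectors $Dh_i(\bar x)$ ($i\in I$), $DF_{1,m}(\bar x)$ ($m\in\alpha(\bar x)$), $DF_{2,m}(\bar x)$ ($m\in\gamma(\bar x)$), $Dg_j(\bar x)$ ($j\in J_0(\bar x)$), $DF_{1,m}(\bar x), DF_{2,m}(\bar x)$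 ($m\in\beta(\bar x)$) are linearly independent. W-stationarity: $\bar x\in M$ is W-stationary if there are real multipliers $\bar\lambda_i$ ($i\in I$), $\bar\mu_j$ ($j\in J$), $\bar\sigma_{1,m},\bar\sigma_{2,m}$ ($m=1,\dots,k$) such that $Df(\bar x)=\sum_{i\in I}\bar\lambda_i Dh_i(\bar x)+\sum_{j\in J}\bar\mu_j Dg_j(\bar x)+\sum_{m=1}^k(\bar\sigma_{1,m}DF_{1,m}(\bar x)+\bar\sigma_{2,m}DF_{2,m}(\bar x))$, $\bar\mu_j g_j(\bar x)=0$ and $\bar\mu_j\ge 0$ for all $j\in J$, and $\bar\sigma_{l,m}F_{l,m}(\bar x)=0$ for $l=1,2$, $m=1,\dots,k$. Under LICQ the multipliers are unique. Lagrange function: $L(x,\lambda,\mu,\sigma)=f(x)-\sum_{i\in I}\lambda_i h_i(x)-\sum_{j\in J}\mu_j g_j(x)-\sum_{m=1}^k(\sigma_{1,m}F_{1,m}(x)+\sigma_{2,m}F_{2,m}(x))$. Tangent space: $T_{\bar x}M_0(\bar x)=\{\xi\in\mathbb{R}^n\mid Dh_i(\bar x)\xi=0\ (i\in I),\ Dg_j(\bar x)\xi=0\ (j\in J_0(\bar x)),\ DF_{1,m}(\bar x)\xi=0\ (m\in\alpha(\bar x)),\ DF_{2,m}(\bar x)\xi=0\ (m\in\gamma(\bar x)),\ DF_{1,m}(\bar x)\xi=DF_{2,m}(\bar x)\xi=0\ (m\in\beta(\bar x))\}$. The restriction of $D^2_{xx}L$ to this space means $V^T D^2_{xx}L\,V$,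 where the columns of $V$ form a basis of the space. Nondegeneracy: a W-stationary point $\bar x$ with multipliers $(\bar\lambda,\bar\mu,\bar\sigma)$ is nondegenerate if ND1: LICQ holds at $\bar x$; ND2: $\bar\mu_j>0$ for all $j\in J_0(\bar x)$; ND3: $\bar\sigma_{1,m}\bar\sigma_{2,m}\ne 0$ for all $m\in\beta(\bar x)$; ND4: $D^2_{xx}L(\bar x,\bar\lambda,\bar\mu,\bar\sigma)$ restricted to $T_{\bar x}M_0(\bar x)$ is nonsingular. Strong stability: let $B(\bar x,r)=\{x\in\mathbb{R}^n\mid\|x-\bar x\|\le r\}$ and let $\|(f,h,g,F_1,F_2)\|^{C^2}_{B(\bar x,r)}$ be the maximum modulus, over $B(\bar x,r)$, of the function values and partial derivatives up to order two of (all components of) $f,h,g,F_1,F_2$. A W-stationary point $\bar x$ for MPSC$[f,h,g,F_1,F_2]$ is called strongly stable if for some $r>0$ and each $\varepsilon\in(0,r]$ there exists $\delta=\delta(\varepsilon)>0$ such that whenever $\widetilde f,\widetilde h,\widetilde g,\widetilde F_1,\widetilde F_2$ are $C^2$ functions (with the same domains and codomains) with $\|(f-\widetilde f,h-\widetilde h,g-\widetilde g,F_1-\widetilde F_1,F_2-\widetilde F_2)\|^{C^2}_{B(\bar x,r)}\le\delta$, the ball $B(\bar x,\varepsilon)$ contains a W-stationary point $\widetilde x$ for MPSC$[\widetilde f,\widetilde h,\widetilde g,\widetilde F_1,\widetilde F_2]$ which is unique in $B(\bar x,r)$ (i.e. the only W-stationary point of the perturbed problem in $B(\bar x,r)$).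 *)

theory Defs
  imports "HOL-Analysis.Analysis" "Jordan_Normal_Form.Matrix"
begin

section \<open>Twice continuously differentiable functions\<close>

definition partial_deriv :: "'n \<Rightarrow> (real ^ 'n::finite \<Rightarrow> real) \<Rightarrow> real ^ 'n \<Rightarrow> real" where
  "partial_deriv p \<phi> x = frechet_derivative \<phi> (at x) (axis p 1)"

definition C1 :: "(real ^ 'n::finite \<Rightarrow> real) \<Rightarrow> bool" where
  "C1 \<phi> \<longleftrightarrow> \<phi> differentiable_on UNIV \<and> (\<forall>p. continuous_on UNIV (partial_deriv p \<phi>))"

definition C2 :: "(real ^ 'n::finite \<Rightarrow> real) \<Rightarrow> bool" where
  "C2 \<phi> \<longleftrightarrow> C1 \<phi> \<and> (\<forall>p. C1 (partial_deriv p \<phi>))"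

definition gradient :: "(real ^ 'n::finite \<Rightarrow> real) \<Rightarrow> real ^ 'n \<Rightarrow> real ^ 'n" where
  "gradient \<phi> x = (\<chi> p. partial_deriv p \<phi> x)"

definition hessian :: "(real ^ 'n::finite \<Rightarrow> real) \<Rightarrow> real ^ 'n \<Rightarrow> real ^ 'n ^ 'n" where
  "hessian \<phi> x = (\<chi> p q. partial_deriv p (partial_deriv q \<phi>) x)"

text \<open>The moduli of all function values and of all partial derivatives up to order two
  on \<open>B\<close> of the functions in \<open>\<Phi>\<close>, and their supremum. The supremum is a maximum if
  \<open>\<Phi>\<close> is a finite nonempty set of \<open>C\<^sup>2\<close> functions and \<open>B\<close> is compact and nonempty.\<close>

definition C2_moduli :: "(real ^ 'n::finite \<Rightarrow> real) set \<Rightarrow> (real ^ 'n) set \<Rightarrow> real set" where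
  "C2_moduli \<Phi> B =
     {\<bar>\<phi> x\<bar> | \<phi> x. \<phi> \<in> \<Phi> \<and> x \<in> B} \<union>
     {\<bar>partial_deriv p \<phi> x\<bar> | p \<phi> x. \<phi> \<in> \<Phi> \<and> x \<in> B} \<union>
     {\<bar>partial_deriv p (partial_deriv q \<phi>) x\<bar> | p q \<phi> x. \<phi> \<in> \<Phi> \<and> x \<in> B}"

definition C2_norm :: "(real ^ 'n::finite \<Rightarrow> real) set \<Rightarrow> (real ^ 'n) set \<Rightarrow> real" where
  "C2_norm \<Phi> B = Sup (C2_moduli \<Phi> B)"

section \<open>Mathematical programs with switching constraints\<close>

text \<open>The finite index sets \<open>I\<close> and \<open>J\<close> and the number \<open>k\<close> of switching constraints are separate
  parameters, shared by a program and its perturbations; they may be empty, respectively zero.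
  Only components with index in \<open>I\<close>, \<open>J\<close> and \<open>{1..k}\<close> are relevant.\<close>

record ('n::finite, 'i, 'j) mpsc =
  objf :: "real ^ 'n \<Rightarrow> real"
  eqf :: "'i \<Rightarrow> real ^ 'n \<Rightarrow> real"
  ineqf :: "'j \<Rightarrow> real ^ 'n \<Rightarrow> real"
  F1 :: "nat \<Rightarrow> real ^ 'n \<Rightarrow> real"
  F2 :: "nat \<Rightarrow> real ^ 'n \<Rightarrow> real"

definition components ::
    "'i set \<Rightarrow> 'j set \<Rightarrow> nat \<Rightarrow> ('n::finite, 'i, 'j) mpsc \<Rightarrow> (real ^ 'n \<Rightarrow> real) set" where
  "components I J k P =
     {objf P} \<union> eqf P ` I \<union> ineqf P ` J \<union> F1 P ` {1..k} \<union> F2 P ` {1..k}"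

definition C2_mpsc :: "'i set \<Rightarrow> 'j set \<Rightarrow> nat \<Rightarrow> ('n::finite, 'i, 'j) mpsc \<Rightarrow> bool" where
  "C2_mpsc I J k P \<longleftrightarrow> (\<forall>\<phi> \<in> components I J k P. C2 \<phi>)"

definition mpsc_diff ::
    "('n::finite, 'i, 'j) mpsc \<Rightarrow> ('n, 'i, 'j) mpsc \<Rightarrow> ('n, 'i, 'j) mpsc" where
  "mpsc_diff P Q =
     \<lparr> objf = (\<lambda>x. objf P x - objf Q x),
       eqf = (\<lambda>i x. eqf P i x - eqf Q i x),
       ineqf = (\<lambda>j x. ineqf P j x - ineqf Q j x),
       F1 = (\<lambda>m x. F1 P m x - F1 Q m x),
       F2 = (\<lambda>m x. F2 P m x - F2 Q m x) \<rparr>"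

definition feasible_set ::
    "'i set \<Rightarrow> 'j set \<Rightarrow> nat \<Rightarrow> ('n::finite, 'i, 'j) mpsc \<Rightarrow> (real ^ 'n) set" where
  "feasible_set I J k P =
     {x. (\<forall>i\<in>I. eqf P i x = 0) \<and> (\<forall>j\<in>J. ineqf P j x \<ge> 0) \<and>
         (\<forall>m\<in>{1..k}. F1 P m x * F2 P m x = 0)}"

definition J0 :: "'j set \<Rightarrow> ('n::finite, 'i, 'j) mpsc \<Rightarrow> real ^ 'n \<Rightarrow> 'j set" where
  "J0 J P x = {j \<in> J. ineqf P j x = 0}"

definition \<alpha>_set :: "nat \<Rightarrow> ('n::finite, 'i, 'j) mpsc \<Rightarrow> real ^ 'n \<Rightarrow> nat set" where
  "\<alpha>_set k P x = {m \<in> {1..k}. F1 P m x = 0 \<and> F2 P m x \<noteq> 0}"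

definition \<beta>_set :: "nat \<Rightarrow> ('n::finite, 'i, 'j) mpsc \<Rightarrow> real ^ 'n \<Rightarrow> nat set" where
  "\<beta>_set k P x = {m \<in> {1..k}. F1 P m x = 0 \<and> F2 P m x = 0}"

definition \<gamma>_set :: "nat \<Rightarrow> ('n::finite, 'i, 'j) mpsc \<Rightarrow> real ^ 'n \<Rightarrow> nat set" where
  "\<gamma>_set k P x = {m \<in> {1..k}. F1 P m x \<noteq> 0 \<and> F2 P m x = 0}"

text \<open>Labels for the constraint functions, so that LICQ refers to an indexed family of gradients:
  equal gradients of two different active constraints violate it.\<close>

datatype ('i, 'j) label = Eq 'i | Ineq 'j | Sw1 nat | Sw2 nat

primrec constraint ::
    "('n::finite, 'i, 'j) mpsc \<Rightarrow> ('i, 'j) label \<Rightarrow> real ^ 'n \<Rightarrow> real" where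
  "constraint P (Eq i) = eqf P i"
| "constraint P (Ineq j) = ineqf P j"
| "constraint P (Sw1 m) = F1 P m"
| "constraint P (Sw2 m) = F2 P m"

definition active ::
    "'i set \<Rightarrow> 'j set \<Rightarrow> nat \<Rightarrow> ('n::finite, 'i, 'j) mpsc \<Rightarrow> real ^ 'n \<Rightarrow> ('i, 'j) label set" where
  "active I J k P x =
     Eq ` I \<union> Sw1 ` \<alpha>_set k P x \<union> Sw2 ` \<gamma>_set k P x \<union> Ineq ` J0 J P x \<union>
     Sw1 ` \<beta>_set k P x \<union> Sw2 ` \<beta>_set k P x"

definition LICQ ::
    "'i set \<Rightarrow> 'j set \<Rightarrow> nat \<Rightarrow> ('n::finite, 'i, 'j) mpsc \<Rightarrow> real ^ 'n \<Rightarrow> bool" where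
  "LICQ I J k P x \<longleftrightarrow>
     inj_on (\<lambda>c. gradient (constraint P c) x) (active I J k P x) \<and>
     independent ((\<lambda>c. gradient (constraint P c) x) ` active I J k P x)"

definition W_multipliers ::
    "'i set \<Rightarrow> 'j set \<Rightarrow> nat \<Rightarrow> ('n::finite, 'i, 'j) mpsc \<Rightarrow> real ^ 'n \<Rightarrow>
     ('i \<Rightarrow> real) \<Rightarrow> ('j \<Rightarrow> real) \<Rightarrow> (nat \<Rightarrow> real) \<Rightarrow> (nat \<Rightarrow> real) \<Rightarrow> bool" where
  "W_multipliers I J k P x lam \<mu> \<sigma>1 \<sigma>2 \<longleftrightarrow>
     gradient (objf P) x =
       (\<Sum>i\<in>I. lam i *\<^sub>R gradient (eqf P i) x) +
       (\<Sum>j\<in>J. \<mu> j *\<^sub>R gradient (ineqf P j) x) +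
       (\<Sum>m=1..k. \<sigma>1 m *\<^sub>R gradient (F1 P m) x + \<sigma>2 m *\<^sub>R gradient (F2 P m) x) \<and>
     (\<forall>j\<in>J. \<mu> j * ineqf P j x = 0 \<and> \<mu> j \<ge> 0) \<and>
     (\<forall>m\<in>{1..k}. \<sigma>1 m * F1 P m x = 0 \<and> \<sigma>2 m * F2 P m x = 0)"

definition W_stationary ::
    "'i set \<Rightarrow> 'j set \<Rightarrow> nat \<Rightarrow> ('n::finite, 'i, 'j) mpsc \<Rightarrow> real ^ 'n \<Rightarrow> bool" where
  "W_stationary I J k P x \<longleftrightarrow>
     x \<in> feasible_set I J k P \<and> (\<exists>lam \<mu> \<sigma>1 \<sigma>2. W_multipliers I J k P x lam \<mu> \<sigma>1 \<sigma>2)"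

definition lagrangian ::
    "'i set \<Rightarrow> 'j set \<Rightarrow> nat \<Rightarrow> ('n::finite, 'i, 'j) mpsc \<Rightarrow>
     ('i \<Rightarrow> real) \<Rightarrow> ('j \<Rightarrow> real) \<Rightarrow> (nat \<Rightarrow> real) \<Rightarrow> (nat \<Rightarrow> real) \<Rightarrow> real ^ 'n \<Rightarrow> real" where
  "lagrangian I J k P lam \<mu> \<sigma>1 \<sigma>2 x =
     objf P x - (\<Sum>i\<in>I. lam i * eqf P i x) - (\<Sum>j\<in>J. \<mu> j * ineqf P j x) -
     (\<Sum>m=1..k. \<sigma>1 m * F1 P m x + \<sigma>2 m * F2 P m x)"

definition tangent_space ::
    "'i set \<Rightarrow> 'j set \<Rightarrow> nat \<Rightarrow> ('n::finite, 'i, 'j) mpsc \<Rightarrow> real ^ 'n \<Rightarrow> (real ^ 'n) set" where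
  "tangent_space I J k P x =
     {\<xi>. (\<forall>i\<in>I. inner (gradient (eqf P i) x) \<xi> = 0) \<and>
         (\<forall>j\<in>J0 J P x. inner (gradient (ineqf P j) x) \<xi> = 0) \<and>
         (\<forall>m\<in>\<alpha>_set k P x. inner (gradient (F1 P m) x) \<xi> = 0) \<and>
         (\<forall>m\<in>\<gamma>_set k P x. inner (gradient (F2 P m) x) \<xi> = 0) \<and>
         (\<forall>m\<in>\<beta>_set k P x. inner (gradient (F1 P m) x) \<xi> = 0 \<and>
                              inner (gradient (F2 P m) x) \<xi> = 0)}"

text \<open>\<open>restricted_mat A vs\<close> is \<open>V\<^sup>T A V\<close>, where \<open>V\<close> has the columns \<open>vs\<close>. The number of columns is
  the dimension of a subspace that depends on the point, whence a matrix type without fixed size.\<close>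

definition restricted_mat :: "real ^ 'n::finite ^ 'n \<Rightarrow> (real ^ 'n) list \<Rightarrow> real mat" where
  "restricted_mat A vs =
     Matrix.mat (length vs) (length vs) (\<lambda>(a, b). inner (vs ! a) (A *v (vs ! b)))"

definition nonsingular_on :: "real ^ 'n::finite ^ 'n \<Rightarrow> (real ^ 'n) set \<Rightarrow> bool" where
  "nonsingular_on A T \<longleftrightarrow>
     (\<exists>vs. distinct vs \<and> independent (set vs) \<and> span (set vs) = T \<and>
           invertible_mat (restricted_mat A vs))"

definition nondegenerate ::
    "'i set \<Rightarrow> 'j set \<Rightarrow> nat \<Rightarrow> ('n::finite, 'i, 'j) mpsc \<Rightarrow> real ^ 'n \<Rightarrow> bool" where
  "nondegenerate I J k P x \<longleftrightarrow>
     x \<in> feasible_set I J k P \<and>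
     (\<exists>lam \<mu> \<sigma>1 \<sigma>2.
        W_multipliers I J k P x lam \<mu> \<sigma>1 \<sigma>2 \<and>
        LICQ I J k P x \<and>
        (\<forall>j\<in>J0 J P x. \<mu> j > 0) \<and>
        (\<forall>m\<in>\<beta>_set k P x. \<sigma>1 m * \<sigma>2 m \<noteq> 0) \<and>
        nonsingular_on (hessian (lagrangian I J k P lam \<mu> \<sigma>1 \<sigma>2) x)
          (tangent_space I J k P x))"

definition strongly_stable ::
    "'i set \<Rightarrow> 'j set \<Rightarrow> nat \<Rightarrow> ('n::finite, 'i, 'j) mpsc \<Rightarrow> real ^ 'n \<Rightarrow> bool" where
  "strongly_stable I J k P x \<longleftrightarrow>
     W_stationary I J k P x \<and>
     (\<exists>r>0. \<forall>\<epsilon>\<in>{0<..r}. \<exists>\<delta>>0. \<forall>Q.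
        C2_mpsc I J k Q \<and>
        C2_norm (components I J k (mpsc_diff P Q)) (cball x r) \<le> \<delta> \<longrightarrow>
        (\<exists>y\<in>cball x \<epsilon>. W_stationary I J k Q y \<and>
           (\<forall>z\<in>cball x r. W_stationary I J k Q z \<longrightarrow> z = y)))"

end

theory Submission
  imports Defs "Jordan_Normal_Form.Determinant"
begin

text \<open>
Let \<open>A\<close> be the set of the constraint functions that vanish at \<open>x\<close>; no inequality belongs to it.

Nondegeneracy implies strong stability. In a small ball and for all nearby programs, the functions
that do not vanish at \<open>x\<close> keep their signs. Hence the multipliers of a W-stationary point \<open>y\<close> in the
ball are supported on \<open>A\<close>, and LICQ forces them to be close to those of \<open>x\<close>
(\<open>eventually_multipliers_close\<close>). For a pair of switching functions that both vanish at \<open>x\<close>, both multipliers are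
then nonzero by ND3, so that both functions vanish at \<open>y\<close> by complementarity. So the W-stationary
points in the ball correspond to the solutions \<open>(y, \<nu>)\<close> of the square system
\<open>\<nabla>f(y) = \<Sum> \<nu> c \<nabla>c(y)\<close>, \<open>c(y) = 0\<close> for \<open>c \<in> A\<close>. By LICQ and ND4 the derivative of this system at \<open>x\<close>
is injective (\<open>inj_kkt_op\<close>). For all programs near in the \<open>C\<^sup>2\<close> sense the system differs from this
linear map by a map with a small Lipschitz constant (\<open>eventually_kkt_map_almost_linear\<close>), so Banach's
fixed point theorem gives exactly one zero.

Conversely, let \<open>x\<close> be W-stationary with LICQ, let \<open>H\<close> be the Hessian of the Lagrangian, and
suppose that ND4 or ND3 fails. Then there are a direction \<open>\<xi> \<noteq> 0\<close>, coefficients \<open>\<nu>\<close> and a set \<open>B \<subseteq> A\<close>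
such that the multipliers vanish outside \<open>B\<close>, each switching pair has a member in \<open>B\<close>, \<open>\<xi>\<close> is
orthogonal to the gradients of the functions in \<open>B\<close>, and \<open>H\<close> maps \<open>\<xi>\<close> to \<open>\<Sum> \<nu> c \<nabla>c(x)\<close>, the sum
over \<open>A\<close>. If ND4 fails, \<open>B = A\<close> and \<open>\<xi>\<close> is a kernel vector of the restricted Hessian. If ND4 holds
and the multiplier of a function \<open>c0\<close> in a biactive pair is zero, \<open>B = A - {c0}\<close> and \<open>\<xi>\<close> comes from the
surjectivity of the linear map above. Up to errors of order \<open>o(s)\<close>, both \<open>x\<close> and \<open>x + s \<xi>\<close> are then
W-stationary after a small multiple of each function in \<open>A - B\<close> has been added to the objective.
Since the two points have distance \<open>s\<close> for a unit vector \<open>\<xi>\<close>, errors in values and gradients of order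
\<open>o(s)\<close> can be removed by linear and quadratic perturbations that are small in the \<open>C\<^sup>2\<close> norm
(\<open>two_W_stationary_points\<close>). So uniqueness fails for arbitrarily small perturbations.
\<close>

(* Leaves the symbol to the components of vectors in a power of the reals. *)
no_notation vec_index (infixl "$" 100)

section \<open>Calculus of twice continuously differentiable functions\<close>

lemma linear_eq_inner_axis:
  fixes D :: "real ^ 'n::finite \<Rightarrow> real"
  assumes "linear D"
  shows "D h = inner (\<chi> p. D (axis p 1)) h"
proof -
  have "D h = D (\<Sum>p\<in>UNIV. (h $ p) *\<^sub>R axis p 1)"
    using basis_expansion[of h] by (simp add: scalar_mult_eq_scaleR)
  also have "\<dots> = (\<Sum>p\<in>UNIV. (h $ p) * D (axis p 1))"
    using assms by (simp add: linear_sum linear_cmul)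
  finally show ?thesis
    by (simp add: inner_vec_def mult.commute)
qed

lemma has_derivative_gradient:
  fixes \<phi> :: "real ^ 'n::finite \<Rightarrow> real"
  assumes "\<phi> differentiable at x"
  shows "(\<phi> has_derivative inner (gradient \<phi> x)) (at x)"
proof -
  have D: "(\<phi> has_derivative frechet_derivative \<phi> (at x)) (at x)"
    using assms frechet_derivative_works by blast
  have "frechet_derivative \<phi> (at x) = inner (gradient \<phi> x)"
    unfolding gradient_def partial_deriv_def
    by (rule ext) (rule linear_eq_inner_axis[OF has_derivative_linear[OF D]])
  with D show ?thesis by simp
qed

lemma partial_deriv_eqI:
  "(\<phi> has_derivative D) (at x) \<Longrightarrow> partial_deriv p \<phi> x = D (axis p 1)"
  unfolding partial_deriv_def by (metis frechet_derivative_at)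

lemma gradient_nth [simp]: "gradient \<phi> x $ p = partial_deriv p \<phi> x"
  by (simp add: gradient_def)

lemma C1_has_derivative: "C1 \<phi> \<Longrightarrow> (\<phi> has_derivative inner (gradient \<phi> x)) (at x)"
  by (rule has_derivative_gradient) (simp add: C1_def differentiable_on_def)

lemma C1_continuous: "C1 \<phi> \<Longrightarrow> continuous_on A \<phi>"
  by (meson C1_has_derivative continuous_at_imp_continuous_on has_derivative_continuous)

lemma C1_partial_continuous: "C1 \<phi> \<Longrightarrow> continuous_on A (partial_deriv p \<phi>)"
  unfolding C1_def by (meson continuous_on_subset subset_UNIV)

lemma C2_imp_C1: "C2 \<phi> \<Longrightarrow> C1 \<phi>"
  and C2_partial_C1: "C2 \<phi> \<Longrightarrow> C1 (partial_deriv p \<phi>)"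
  by (simp_all add: C2_def)

lemma C1_I:
  assumes "\<And>x. (\<phi> has_derivative D x) (at x)"
    and "\<And>p. continuous_on UNIV (\<lambda>x. D x (axis p 1))"
  shows "C1 \<phi>"
proof -
  have "partial_deriv p \<phi> = (\<lambda>x. D x (axis p 1))" for p
    using partial_deriv_eqI[OF assms(1)] by auto
  with assms show ?thesis
    unfolding C1_def differentiable_on_def by (auto intro: differentiableI)
qed

lemma partial_deriv_add:
  assumes "C1 \<phi>" "C1 \<psi>"
  shows "partial_deriv p (\<lambda>x. \<phi> x + \<psi> x) = (\<lambda>x. partial_deriv p \<phi> x + partial_deriv p \<psi> x)"
  by (rule ext, subst partial_deriv_eqI[OF has_derivative_add[OF C1_has_derivative[OF assms(1)]
        C1_has_derivative[OF assms(2)]]]) (simp add: inner_axis)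

lemma partial_deriv_mult:
  assumes "C1 \<phi>" "C1 \<psi>"
  shows "partial_deriv p (\<lambda>x. \<phi> x * \<psi> x) =
    (\<lambda>x. \<phi> x * partial_deriv p \<psi> x + partial_deriv p \<phi> x * \<psi> x)"
  by (rule ext, subst partial_deriv_eqI[OF has_derivative_mult[OF C1_has_derivative[OF assms(1)]
        C1_has_derivative[OF assms(2)]]]) (simp add: inner_axis)

lemma partial_deriv_const: "partial_deriv p (\<lambda>x. a) = (\<lambda>x. 0)"
  by (rule ext, subst partial_deriv_eqI[OF has_derivative_const]) simp

lemma partial_deriv_inner: "partial_deriv p (\<lambda>x. inner (x - a) v) = (\<lambda>x. v $ p)"
proof
  fix x
  have "((\<lambda>x. inner (x - a) v) has_derivative (\<lambda>h. inner h v)) (at x)"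
    by (auto intro!: derivative_eq_intros)
  from partial_deriv_eqI[OF this]
  show "partial_deriv p (\<lambda>x. inner (x - a) v) x = v $ p"
    by (simp add: inner_axis')
qed

lemma C1_const: "C1 (\<lambda>x. a)"
  by (rule C1_I[of _ "\<lambda>x h. 0"]) auto

lemma C1_add:
  assumes "C1 \<phi>" "C1 \<psi>"
  shows "C1 (\<lambda>x. \<phi> x + \<psi> x)"
  by (rule C1_I, rule has_derivative_add[OF C1_has_derivative[OF assms(1)] C1_has_derivative[OF assms(2)]])
    (auto simp: inner_axis intro!: continuous_intros C1_partial_continuous assms)

lemma C1_mult:
  assumes "C1 \<phi>" "C1 \<psi>"
  shows "C1 (\<lambda>x. \<phi> x * \<psi> x)"
  by (rule C1_I, rule has_derivative_mult[OF C1_has_derivative[OF assms(1)] C1_has_derivative[OF assms(2)]])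
    (auto simp: inner_axis intro!: continuous_intros C1_partial_continuous assms C1_continuous[OF assms(1)]
      C1_continuous[OF assms(2)])

lemma C2_const: "C2 (\<lambda>x. a)"
  by (simp add: C2_def partial_deriv_const C1_const)

lemma C2_add: "C2 \<phi> \<Longrightarrow> C2 \<psi> \<Longrightarrow> C2 (\<lambda>x. \<phi> x + \<psi> x)"
  by (simp add: C2_def partial_deriv_add C1_add)

lemma C2_mult:
  assumes "C2 \<phi>" "C2 \<psi>"
  shows "C2 (\<lambda>x. \<phi> x * \<psi> x)"
proof -
  have "C1 (\<lambda>x. \<phi> x * partial_deriv p \<psi> x + partial_deriv p \<phi> x * \<psi> x)" for p
    by (rule C1_add; rule C1_mult) (simp_all add: assms C2_imp_C1 C2_partial_C1)
  then show ?thesis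
    using assms[THEN C2_imp_C1] by (simp add: C2_def partial_deriv_mult C1_mult)
qed

lemma C2_inner: "C2 (\<lambda>x. inner (x - a) v)"
proof -
  have "C1 (\<lambda>x. inner (x - a) v)"
    by (rule C1_I[of _ "\<lambda>x h. inner h v"]) (auto intro!: derivative_eq_intros continuous_intros)
  then show ?thesis by (simp add: C2_def partial_deriv_inner C1_const)
qed

lemma C2_cmult: "C2 \<phi> \<Longrightarrow> C2 (\<lambda>x. a * \<phi> x)"
  by (rule C2_mult[OF C2_const])

lemma C2_diff: "C2 \<phi> \<Longrightarrow> C2 \<psi> \<Longrightarrow> C2 (\<lambda>x. \<phi> x - \<psi> x)"
  using C2_add[of \<phi> "\<lambda>x. (-1) * \<psi> x"] C2_cmult[of \<psi> "-1"] by simp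

lemma C2_sum: "(\<And>i. i \<in> K \<Longrightarrow> C2 (\<phi> i)) \<Longrightarrow> C2 (\<lambda>x. \<Sum>i\<in>K. \<phi> i x)"
  by (induction K rule: infinite_finite_induct) (simp_all add: C2_const C2_add)

lemma partial_deriv_cmult:
  "C1 \<phi> \<Longrightarrow> partial_deriv p (\<lambda>x. a * \<phi> x) = (\<lambda>x. a * partial_deriv p \<phi> x)"
  by (simp add: partial_deriv_mult[OF C1_const] partial_deriv_const)

lemma partial_deriv_diff:
  assumes "C1 \<phi>" "C1 \<psi>"
  shows "partial_deriv p (\<lambda>x. \<phi> x - \<psi> x) = (\<lambda>x. partial_deriv p \<phi> x - partial_deriv p \<psi> x)"
  using partial_deriv_add[OF assms(1) C1_mult[OF C1_const[of "-1"] assms(2)], of p]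
  unfolding partial_deriv_cmult[OF assms(2)] by simp

lemma partial_deriv_sum:
  "(\<And>i. i \<in> K \<Longrightarrow> C2 (\<phi> i)) \<Longrightarrow>
    partial_deriv p (\<lambda>x. \<Sum>i\<in>K. \<phi> i x) = (\<lambda>x. \<Sum>i\<in>K. partial_deriv p (\<phi> i) x)"
  by (induction K rule: infinite_finite_induct)
    (simp_all add: partial_deriv_const partial_deriv_add C2_imp_C1 C2_sum)

lemma gradient_add:
  "C1 \<phi> \<Longrightarrow> C1 \<psi> \<Longrightarrow> gradient (\<lambda>x. \<phi> x + \<psi> x) x = gradient \<phi> x + gradient \<psi> x"
  by (simp add: Finite_Cartesian_Product.vec_eq_iff partial_deriv_add)

lemma gradient_diff:
  "C1 \<phi> \<Longrightarrow> C1 \<psi> \<Longrightarrow> gradient (\<lambda>x. \<phi> x - \<psi> x) x = gradient \<phi> x - gradient \<psi> x"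
  by (simp add: Finite_Cartesian_Product.vec_eq_iff partial_deriv_diff)

lemma gradient_cmult: "C1 \<phi> \<Longrightarrow> gradient (\<lambda>x. a * \<phi> x) x = a *\<^sub>R gradient \<phi> x"
  by (simp add: Finite_Cartesian_Product.vec_eq_iff partial_deriv_cmult)

lemma gradient_mult:
  "C1 \<phi> \<Longrightarrow> C1 \<psi> \<Longrightarrow>
    gradient (\<lambda>x. \<phi> x * \<psi> x) x = \<phi> x *\<^sub>R gradient \<psi> x + \<psi> x *\<^sub>R gradient \<phi> x"
  by (simp add: Finite_Cartesian_Product.vec_eq_iff partial_deriv_mult)

lemma gradient_sum:
  "(\<And>i. i \<in> K \<Longrightarrow> C2 (\<phi> i)) \<Longrightarrow>
    gradient (\<lambda>x. \<Sum>i\<in>K. \<phi> i x) x = (\<Sum>i\<in>K. gradient (\<phi> i) x)"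
  by (simp add: Finite_Cartesian_Product.vec_eq_iff partial_deriv_sum)

lemma gradient_inner: "gradient (\<lambda>x. inner (x - a) v) x = v"
  by (simp add: Finite_Cartesian_Product.vec_eq_iff partial_deriv_inner)

text \<open>The derivative of the gradient is multiplication by the transposed Hessian, since
  \<^const>\<open>hessian\<close> has the outer derivative as its row index.\<close>

lemma inner_gradient_partial_deriv:
  "inner (gradient (partial_deriv q \<phi>) x) h = (h v* hessian \<phi> x) $ q"
  by (simp add: inner_vec_def vector_matrix_mult_def hessian_def mult.commute)

lemma has_derivative_gradient_hessian:
  assumes "C2 \<phi>"
  shows "(gradient \<phi> has_derivative (\<lambda>h. h v* hessian \<phi> x)) (at x)"
proof -
  have "((\<lambda>y. gradient \<phi> y $ q) has_derivative (\<lambda>h. (h v* hessian \<phi> x) $ q)) (at x)" for q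
    using C1_has_derivative[OF C2_partial_C1[OF assms, of q], of x]
    unfolding gradient_nth inner_gradient_partial_deriv[symmetric] .
  then show ?thesis
    by (subst has_derivative_componentwise_within)
      (auto simp: Basis_vec_def inner_axis)
qed

section \<open>The \<open>C\<^sup>2\<close> norm\<close>

definition C2_le :: "(real ^ 'n::finite \<Rightarrow> real) \<Rightarrow> (real ^ 'n) set \<Rightarrow> real \<Rightarrow> bool" where
  "C2_le \<phi> B M \<longleftrightarrow>
     (\<forall>x\<in>B. \<bar>\<phi> x\<bar> \<le> M \<and> (\<forall>p. \<bar>partial_deriv p \<phi> x\<bar> \<le> M) \<and>
        (\<forall>p q. \<bar>partial_deriv p (partial_deriv q \<phi>) x\<bar> \<le> M))"

lemma C2_leD:
  assumes "C2_le \<phi> B M" "x \<in> B"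
  shows "\<bar>\<phi> x\<bar> \<le> M" "\<bar>partial_deriv p \<phi> x\<bar> \<le> M"
    "\<bar>partial_deriv p (partial_deriv q \<phi>) x\<bar> \<le> M"
  using assms by (auto simp: C2_le_def)

lemma C2_le_mono: "C2_le \<phi> B M \<Longrightarrow> M \<le> N \<Longrightarrow> C2_le \<phi> B N"
  unfolding C2_le_def by (meson order_trans)

lemma C2_moduli_le_iff: "(\<forall>m\<in>C2_moduli \<Phi> B. m \<le> M) \<longleftrightarrow> (\<forall>\<phi>\<in>\<Phi>. C2_le \<phi> B M)"
  unfolding C2_moduli_def C2_le_def by blast

lemma C2_le_exists:
  fixes \<phi> :: "real ^ 'n::finite \<Rightarrow> real"
  assumes "C2 \<phi>" "compact B"
  shows "\<exists>M. C2_le \<phi> B M"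
proof -
  have bnd: "\<exists>M. \<forall>x\<in>B. \<bar>\<psi> x\<bar> \<le> M" if "continuous_on B \<psi>" for \<psi> :: "real ^ 'n \<Rightarrow> real"
    using compact_imp_bounded[OF compact_continuous_image[OF that assms(2)]]
    by (auto simp: bounded_iff)
  obtain M0 where M0: "\<forall>x\<in>B. \<bar>\<phi> x\<bar> \<le> M0"
    using bnd[OF C1_continuous[OF C2_imp_C1[OF assms(1)]]] by blast
  have "\<exists>M. \<forall>x\<in>B. \<bar>partial_deriv p \<phi> x\<bar> \<le> M" for p
    using bnd[OF C1_partial_continuous[OF C2_imp_C1[OF assms(1)]]] .
  then obtain M1 where M1: "\<And>p. \<forall>x\<in>B. \<bar>partial_deriv p \<phi> x\<bar> \<le> M1 p" by metis
  have "\<exists>M. \<forall>x\<in>B. \<bar>partial_deriv p (partial_deriv q \<phi>) x\<bar> \<le> M" for p q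
    using bnd[OF C1_partial_continuous[OF C2_partial_C1[OF assms(1)]]] .
  then obtain M2 where M2: "\<And>p q. \<forall>x\<in>B. \<bar>partial_deriv p (partial_deriv q \<phi>) x\<bar> \<le> M2 p q" by metis
  define M where "M = Max (insert M0 (range M1 \<union> range (case_prod M2)))"
  have fin: "finite (insert M0 (range M1 \<union> range (case_prod M2)))" by simp
  have "M0 \<le> M" "M1 p \<le> M" "M2 p q \<le> M" for p q
    using Max_ge[OF fin, of M0] Max_ge[OF fin, of "M1 p"]
      Max_ge[OF fin, OF insertI2[OF UnI2[OF rangeI[of "case_prod M2" "(p, q)"]]]]
    unfolding M_def by simp_all
  then have "C2_le \<phi> B M"
    unfolding C2_le_def using M0 M1 M2 by (blast intro: order_trans)
  then show ?thesis ..
qed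

lemma C2_norm_le_iff:
  assumes "finite \<Phi>" "\<Phi> \<noteq> {}" "B \<noteq> {}" "compact B" "\<And>\<phi>. \<phi> \<in> \<Phi> \<Longrightarrow> C2 \<phi>"
  shows "C2_norm \<Phi> B \<le> M \<longleftrightarrow> (\<forall>\<phi>\<in>\<Phi>. C2_le \<phi> B M)"
proof -
  have "\<forall>\<phi>\<in>\<Phi>. \<exists>N. C2_le \<phi> B N" using C2_le_exists assms by blast
  then obtain N where N: "\<forall>\<phi>\<in>\<Phi>. C2_le \<phi> B (N \<phi>)" by metis
  have "\<forall>\<phi>\<in>\<Phi>. C2_le \<phi> B (Max (N ` \<Phi>))"
    using N assms(1) by (auto intro: C2_le_mono)
  then have bdd: "bdd_above (C2_moduli \<Phi> B)"
    using C2_moduli_le_iff[of \<Phi> B "Max (N ` \<Phi>)"] unfolding bdd_above_def by blast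
  have ne: "C2_moduli \<Phi> B \<noteq> {}"
    using assms(2,3) unfolding C2_moduli_def by blast
  show ?thesis
    unfolding C2_norm_def cSup_le_iff[OF ne bdd] C2_moduli_le_iff ..
qed

lemma C2_le_cmult: "C2 \<phi> \<Longrightarrow> C2_le \<phi> B M \<Longrightarrow> C2_le (\<lambda>x. a * \<phi> x) B (\<bar>a\<bar> * M)"
  unfolding C2_le_def
  by (simp add: partial_deriv_cmult C2_imp_C1 C2_partial_C1 abs_mult mult_left_mono)

lemma C2_le_add:
  "C2 \<phi> \<Longrightarrow> C2 \<psi> \<Longrightarrow> C2_le \<phi> B M \<Longrightarrow> C2_le \<psi> B N \<Longrightarrow> C2_le (\<lambda>x. \<phi> x + \<psi> x) B (M + N)"
  unfolding C2_le_def
  by (auto simp: partial_deriv_add C2_imp_C1 C2_partial_C1 intro!: order_trans[OF abs_triangle_ineq] add_mono)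

lemma C2_le_sum:
  "(\<And>i. i \<in> K \<Longrightarrow> C2 (\<phi> i) \<and> C2_le (\<phi> i) B (M i)) \<Longrightarrow>
    C2_le (\<lambda>x. \<Sum>i\<in>K. \<phi> i x) B (\<Sum>i\<in>K. M i)"
  by (induction K rule: infinite_finite_induct)
    (auto simp: C2_le_def[of "\<lambda>x. 0"] partial_deriv_const intro!: C2_le_add C2_sum)

section \<open>Estimates that are uniform over nearby functions\<close>

text \<open>One parameter serves as the radius of the ball and as the tolerance, so that every estimate below
  can be stated for all sufficiently small \<open>d\<close> and finitely many of them can be combined with
  \<^const>\<open>eventually\<close>.\<close>

definition C2_close :: "real \<Rightarrow> real ^ 'n::finite \<Rightarrow> (real ^ 'n \<Rightarrow> real) \<Rightarrow> (real ^ 'n \<Rightarrow> real) \<Rightarrow> bool" where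
  "C2_close d x \<phi> \<psi> \<longleftrightarrow> C2 \<psi> \<and> C2_le (\<lambda>y. \<phi> y - \<psi> y) (cball x d) d"

lemma C2_closeD:
  assumes "C2 \<phi>" "C2_close d x \<phi> \<psi>" "y \<in> cball x d"
  shows "\<bar>\<phi> y - \<psi> y\<bar> \<le> d" "\<bar>partial_deriv p \<phi> y - partial_deriv p \<psi> y\<bar> \<le> d"
    "\<bar>partial_deriv p (partial_deriv q \<phi>) y - partial_deriv p (partial_deriv q \<psi>) y\<bar> \<le> d"
  using assms C2_leD[of "\<lambda>y. \<phi> y - \<psi> y" "cball x d" d y]
  by (simp_all add: C2_close_def partial_deriv_diff C2_partial_C1 C2_imp_C1)

lemma eventually_cball_near:
  fixes \<phi> :: "real ^ 'n::finite \<Rightarrow> real"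
  assumes "continuous_on UNIV \<phi>" "\<kappa> > 0"
  shows "\<forall>\<^sub>F d in at_right 0. \<forall>y\<in>cball x d. \<bar>\<phi> y - \<phi> x\<bar> \<le> \<kappa>"
proof -
  obtain e where "e > 0" and e: "\<And>y. dist y x < e \<Longrightarrow> dist (\<phi> y) (\<phi> x) < \<kappa>"
    using assms unfolding continuous_on_iff by (metis UNIV_I)
  show ?thesis
    unfolding eventually_at_right_field
  proof (intro exI[of _ e] conjI \<open>e > 0\<close> allI impI ballI)
    fix d y assume "0 < d" "d < e" "y \<in> cball x d"
    then show "\<bar>\<phi> y - \<phi> x\<bar> \<le> \<kappa>"
      using e[of y] by (simp add: dist_commute dist_real_def)
  qed
qed

lemma eventually_at_right_0_le: "\<kappa> > 0 \<Longrightarrow> \<forall>\<^sub>F d in at_right (0::real). d \<le> \<kappa>"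
  unfolding eventually_at_right_field by (intro exI[of _ \<kappa>]) auto

text \<open>On a small ball the data of \<open>\<phi>\<close> are almost constant by continuity, and those of \<open>\<psi>\<close> differ
  from them by at most \<open>d\<close>; half of \<open>\<kappa>\<close> is left to each of the two errors.\<close>

lemma eventually_C2_close:
  fixes \<phi> :: "real ^ 'n::finite \<Rightarrow> real"
  assumes \<phi>: "C2 \<phi>" and "\<kappa> > 0"
  shows "\<forall>\<^sub>F d in at_right 0. \<forall>\<psi>. C2_close d x \<phi> \<psi> \<longrightarrow> (\<forall>y\<in>cball x d.
    \<bar>\<psi> y - \<phi> x\<bar> \<le> \<kappa> \<and> (\<forall>p. \<bar>partial_deriv p \<psi> y - partial_deriv p \<phi> x\<bar> \<le> \<kappa>) \<and>
    (\<forall>p q. \<bar>partial_deriv p (partial_deriv q \<psi>) y - partial_deriv p (partial_deriv q \<phi>) x\<bar> \<le> \<kappa>))"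
proof -
  have \<kappa>2: "\<kappa> / 2 > 0" using \<open>\<kappa> > 0\<close> by simp
  have 0: "\<forall>\<^sub>F d in at_right 0. \<forall>y\<in>cball x d. \<bar>\<phi> y - \<phi> x\<bar> \<le> \<kappa> / 2"
    by (rule eventually_cball_near[OF C1_continuous[OF C2_imp_C1[OF \<phi>]] \<kappa>2])
  have 1: "\<forall>\<^sub>F d in at_right 0. \<forall>p. \<forall>y\<in>cball x d.
      \<bar>partial_deriv p \<phi> y - partial_deriv p \<phi> x\<bar> \<le> \<kappa> / 2"
    by (intro eventually_all_finite eventually_cball_near \<kappa>2)
      (rule C1_partial_continuous[OF C2_imp_C1[OF \<phi>]])
  have 2: "\<forall>\<^sub>F d in at_right 0. \<forall>p q. \<forall>y\<in>cball x d.
      \<bar>partial_deriv p (partial_deriv q \<phi>) y - partial_deriv p (partial_deriv q \<phi>) x\<bar> \<le> \<kappa> / 2"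
    by (intro eventually_all_finite eventually_cball_near \<kappa>2)
      (rule C1_partial_continuous[OF C2_partial_C1[OF \<phi>]])
  from 0 1 2 eventually_at_right_0_le[OF \<kappa>2] show ?thesis
  proof eventually_elim
    case (elim d)
    have tri: "\<bar>a - c\<bar> \<le> \<kappa>" if "\<bar>b - a\<bar> \<le> d" "\<bar>b - c\<bar> \<le> \<kappa> / 2" for a b c :: real
      using that elim(4) by linarith
    show ?case
    proof (intro allI impI ballI conjI)
      fix \<psi> y p q
      assume close: "C2_close d x \<phi> \<psi>" and y: "y \<in> cball x d"
      note near = C2_closeD[OF \<phi> close y]
      show "\<bar>\<psi> y - \<phi> x\<bar> \<le> \<kappa>"
        using elim(1) y by (intro tri[OF near(1)]) blast
      show "\<bar>partial_deriv p \<psi> y - partial_deriv p \<phi> x\<bar> \<le> \<kappa>"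
        using elim(2) y by (intro tri[OF near(2)]) blast
      show "\<bar>partial_deriv p (partial_deriv q \<psi>) y - partial_deriv p (partial_deriv q \<phi>) x\<bar> \<le> \<kappa>"
        using elim(3) y by (intro tri[OF near(3)]) blast
    qed
  qed
qed

lemma norm_le_CARD_mult:
  fixes v :: "real ^ 'n::finite" and a :: real
  assumes "\<And>p. \<bar>v $ p\<bar> \<le> a"
  shows "norm v \<le> CARD('n) * a"
  using norm_le_l1_cart[of v] sum_mono[of UNIV "\<lambda>p. \<bar>v $ p\<bar>" "\<lambda>p. a"] assms by simp

lemma CARD_div_mult:
  "(\<kappa>::real) > 0 \<Longrightarrow> \<kappa> / CARD('n::finite) > 0"
  "real CARD('n) * (\<kappa> / CARD('n)) = \<kappa>"
  by simp_all

lemma eventually_gradient_close: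
  fixes \<phi> :: "real ^ 'n::finite \<Rightarrow> real"
  assumes "C2 \<phi>" "\<kappa> > 0"
  shows "\<forall>\<^sub>F d in at_right 0. \<forall>\<psi>. C2_close d x \<phi> \<psi> \<longrightarrow> (\<forall>y\<in>cball x d.
    norm (gradient \<psi> y - gradient \<phi> x) \<le> \<kappa>)"
  using eventually_C2_close[OF assms(1) CARD_div_mult(1)[where 'n = 'n, OF assms(2)]]
proof (rule eventually_mono, intro allI impI ballI)
  fix d \<psi> y
  assume "\<forall>\<psi>. C2_close d x \<phi> \<psi> \<longrightarrow> (\<forall>y\<in>cball x d.
    \<bar>\<psi> y - \<phi> x\<bar> \<le> \<kappa> / CARD('n) \<and>
    (\<forall>p. \<bar>partial_deriv p \<psi> y - partial_deriv p \<phi> x\<bar> \<le> \<kappa> / CARD('n)) \<and>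
    (\<forall>p q. \<bar>partial_deriv p (partial_deriv q \<psi>) y - partial_deriv p (partial_deriv q \<phi>) x\<bar>
      \<le> \<kappa> / CARD('n)))" "C2_close d x \<phi> \<psi>" "y \<in> cball x d"
  then have "\<bar>(gradient \<psi> y - gradient \<phi> x) $ p\<bar> \<le> \<kappa> / CARD('n)" for p by simp
  then show "norm (gradient \<psi> y - gradient \<phi> x) \<le> \<kappa>"
    using norm_le_CARD_mult[of "gradient \<psi> y - gradient \<phi> x" "\<kappa> / CARD('n)"]
    by (simp add: CARD_div_mult(2))
qed

text \<open>The mean value inequality for \<open>\<psi>\<close> minus the linear function with gradient \<open>g\<close>. It bounds
  differences of \<open>\<psi>\<close> by the distance of the two points, which is what a contraction argument needs;
  closeness of values alone would not do.\<close>

lemma C1_almost_affine: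
  fixes \<psi> :: "real ^ 'n::finite \<Rightarrow> real" and a :: real
  assumes \<psi>: "C1 \<psi>" and near: "\<And>y p. y \<in> cball x d \<Longrightarrow> \<bar>partial_deriv p \<psi> y - g $ p\<bar> \<le> a"
    and y: "y \<in> cball x d" "z \<in> cball x d"
  shows "\<bar>\<psi> y - \<psi> z - inner g (y - z)\<bar> \<le> CARD('n) * a * norm (y - z)"
proof -
  have "norm ((\<psi> y - inner g y) - (\<psi> z - inner g z)) \<le> CARD('n) * a * norm (y - z)"
  proof (rule differentiable_bound[OF convex_cball _ _ y])
    fix w assume w: "w \<in> cball x d"
    show "((\<lambda>w. \<psi> w - inner g w) has_derivative (\<lambda>h. inner (gradient \<psi> w - g) h))
        (at w within cball x d)"
      unfolding inner_diff_left
      by (intro has_derivative_diff has_derivative_at_withinI[OF C1_has_derivative[OF \<psi>]]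
          has_derivative_inner_right has_derivative_ident)
    have "norm (gradient \<psi> w - g) \<le> CARD('n) * a"
      using near[OF w] by (intro norm_le_CARD_mult) simp
    then show "onorm (\<lambda>h. inner (gradient \<psi> w - g) h) \<le> CARD('n) * a"
      by (intro onorm_le) (metis Cauchy_Schwarz_ineq2 mult_right_mono norm_ge_zero order_trans real_norm_def)
  qed
  then show ?thesis by (simp add: inner_diff_right algebra_simps)
qed

lemma eventually_value_almost_affine:
  fixes \<phi> :: "real ^ 'n::finite \<Rightarrow> real"
  assumes \<phi>: "C2 \<phi>" and "\<kappa> > 0"
  shows "\<forall>\<^sub>F d in at_right 0. \<forall>\<psi>. C2_close d x \<phi> \<psi> \<longrightarrow> (\<forall>y\<in>cball x d. \<forall>z\<in>cball x d.
    \<bar>\<psi> y - \<psi> z - inner (gradient \<phi> x) (y - z)\<bar> \<le> \<kappa> * norm (y - z))"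
  using eventually_C2_close[OF assms(1) CARD_div_mult(1)[where 'n = 'n, OF assms(2)], of x]
proof eventually_elim
  case (elim d)
  show ?case
  proof (intro allI impI ballI)
    fix \<psi> y z assume \<psi>: "C2_close d x \<phi> \<psi>" and yz: "y \<in> cball x d" "z \<in> cball x d"
    have "\<bar>\<psi> y - \<psi> z - inner (gradient \<phi> x) (y - z)\<bar> \<le> CARD('n) * (\<kappa> / CARD('n)) * norm (y - z)"
    proof (rule C1_almost_affine[OF _ _ yz])
      show "C1 \<psi>" using \<psi> by (simp add: C2_close_def C2_def)
      show "\<bar>partial_deriv p \<psi> w - gradient \<phi> x $ p\<bar> \<le> \<kappa> / CARD('n)" if "w \<in> cball x d" for w p
        using elim \<psi> that by simp
    qed
    then show "\<bar>\<psi> y - \<psi> z - inner (gradient \<phi> x) (y - z)\<bar> \<le> \<kappa> * norm (y - z)"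
      by (simp add: CARD_div_mult(2))
  qed
qed

text \<open>Each component of the gradient of \<open>\<psi>\<close> is continuously differentiable, and its partial
  derivatives are second derivatives of \<open>\<psi>\<close>, hence near those of \<open>\<phi>\<close> at \<open>x\<close>. This is the only
  place where closeness of second derivatives enters.\<close>

lemma eventually_gradient_almost_affine:
  fixes \<phi> :: "real ^ 'n::finite \<Rightarrow> real"
  assumes \<phi>: "C2 \<phi>" and "\<kappa> > 0"
  shows "\<forall>\<^sub>F d in at_right 0. \<forall>\<psi>. C2_close d x \<phi> \<psi> \<longrightarrow> (\<forall>y\<in>cball x d. \<forall>z\<in>cball x d.
    norm (gradient \<psi> y - gradient \<psi> z - (y - z) v* hessian \<phi> x) \<le> \<kappa> * norm (y - z))"
  using eventually_C2_close[OF assms(1) CARD_div_mult(1)[where 'n = 'n,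
        OF CARD_div_mult(1)[where 'n = 'n, OF assms(2)]], of x]
proof eventually_elim
  case (elim d)
  show ?case
  proof (intro allI impI ballI)
    fix \<psi> y z assume \<psi>: "C2_close d x \<phi> \<psi>" and yz: "y \<in> cball x d" "z \<in> cball x d"
    have "\<bar>(gradient \<psi> y - gradient \<psi> z - (y - z) v* hessian \<phi> x) $ q\<bar>
        \<le> \<kappa> / CARD('n) * norm (y - z)" for q
    proof -
      have "\<bar>partial_deriv q \<psi> y - partial_deriv q \<psi> z - inner (gradient (partial_deriv q \<phi>) x) (y - z)\<bar>
          \<le> CARD('n) * (\<kappa> / CARD('n) / CARD('n)) * norm (y - z)"
      proof (rule C1_almost_affine[OF _ _ yz])
        show "C1 (partial_deriv q \<psi>)" using \<psi> by (simp add: C2_close_def C2_def)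
        show "\<bar>partial_deriv p (partial_deriv q \<psi>) w - gradient (partial_deriv q \<phi>) x $ p\<bar>
            \<le> \<kappa> / CARD('n) / CARD('n)" if "w \<in> cball x d" for w p
          using elim \<psi> that by simp
      qed
      then show ?thesis
        by (simp add: CARD_div_mult(2) inner_gradient_partial_deriv)
    qed
    from norm_le_CARD_mult[OF this]
    show "norm (gradient \<psi> y - gradient \<psi> z - (y - z) v* hessian \<phi> x) \<le> \<kappa> * norm (y - z)"
      by simp
  qed
qed

section \<open>Linear algebra of the Karush-Kuhn-Tucker system\<close>

lemma span_set_list:
  fixes vs :: "'a::real_vector list"
  assumes "distinct vs"
  shows "span (set vs) = {\<Sum>a<length vs. c a *\<^sub>R vs ! a | c. True}"
proof -
  have bij: "bij_betw ((!) vs) {..<length vs} (set vs)"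
    by (rule bij_betw_nth[OF assms refl refl])
  have sum: "(\<Sum>v\<in>set vs. u v *\<^sub>R v) = (\<Sum>a<length vs. u (vs ! a) *\<^sub>R vs ! a)" for u
    using sum.reindex_bij_betw[OF bij, of "\<lambda>v. u v *\<^sub>R v"] by simp
  have "\<exists>u. (\<Sum>v\<in>set vs. u v *\<^sub>R v) = (\<Sum>a<length vs. c a *\<^sub>R vs ! a)" for c
    unfolding sum using bij
    by (intro exI[of _ "\<lambda>v. c (inv_into {..<length vs} ((!) vs) v)"] sum.cong)
      (auto simp: bij_betw_def)
  then show ?thesis
    unfolding span_finite[OF finite_set] using sum by (auto simp: image_iff) metis+
qed

lemma independent_list_coeffs_0:
  fixes vs :: "'a::real_vector list"
  assumes "distinct vs" "independent (set vs)" "(\<Sum>a<length vs. c a *\<^sub>R vs ! a) = 0" "a < length vs"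
  shows "c a = 0"
proof -
  have bij: "bij_betw ((!) vs) {..<length vs} (set vs)"
    by (rule bij_betw_nth[OF assms(1) refl refl])
  define u where "u = (\<lambda>v. c (inv_into {..<length vs} ((!) vs) v))"
  have u: "u (vs ! a) = c a" if "a < length vs" for a
    using that bij by (auto simp: u_def bij_betw_def)
  have "(\<Sum>v\<in>set vs. u v *\<^sub>R v) = (\<Sum>a<length vs. u (vs ! a) *\<^sub>R vs ! a)"
    using sum.reindex_bij_betw[OF bij, of "\<lambda>v. u v *\<^sub>R v"] by simp
  also have "\<dots> = 0" using assms(3) u by simp
  finally have "u (vs ! a) = 0"
    using independentD[OF assms(2) finite_set subset_refl] assms(4) by simp
  with u assms(4) show ?thesis by simp
qed

text \<open>The form is degenerate on the left exactly if it is degenerate on the right, a square matrix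
  being invertible together with its transpose. The left kernel is the convenient one because
  \<^term>\<open>\<xi> v* hessian \<phi> x\<close> is the derivative of the gradient.\<close>

lemma nonsingular_on_iff:
  fixes A :: "real ^ 'n::finite ^ 'n"
  assumes "subspace T"
  shows "nonsingular_on A T \<longleftrightarrow> (\<forall>\<xi>\<in>T. (\<forall>\<eta>\<in>T. inner \<xi> (A *v \<eta>) = 0) \<longrightarrow> \<xi> = 0)"
proof
  assume "nonsingular_on A T"
  then obtain vs where vs: "distinct vs" "independent (set vs)" "span (set vs) = T"
    and inv: "invertible_mat (restricted_mat A vs)"
    unfolding nonsingular_on_def by blast
  define n where "n = length vs"
  define M where "M = restricted_mat A vs"
  have M: "M \<in> carrier_mat n n" by (simp add: M_def restricted_mat_def n_def)
  have Mab: "M $$ (a, b) = inner (vs ! a) (A *v (vs ! b))" if "a < n" "b < n" for a b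
    using that by (simp add: M_def restricted_mat_def n_def)
  obtain B where "M * B = 1\<^sub>m n" "B * M = 1\<^sub>m (dim_row B)"
    using inv M unfolding M_def[symmetric] invertible_mat_def inverts_mat_def by auto
  then have MB: "M * B = 1\<^sub>m n" and "dim_col B = n" "dim_col M = dim_row B"
    by (metis index_mult_mat(3) index_one_mat(3))+
  then have B: "B \<in> carrier_mat n n"
    using M by (intro carrier_matI) auto
  show "\<forall>\<xi>\<in>T. (\<forall>\<eta>\<in>T. inner \<xi> (A *v \<eta>) = 0) \<longrightarrow> \<xi> = 0"
  proof (intro ballI impI)
    fix \<xi> assume "\<xi> \<in> T" and ker: "\<forall>\<eta>\<in>T. inner \<xi> (A *v \<eta>) = 0"
    then obtain c where \<xi>: "\<xi> = (\<Sum>a<n. c a *\<^sub>R vs ! a)"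
      using span_set_list[OF vs(1)] vs(3) by (auto simp: n_def)
    have cM: "(\<Sum>a<n. c a * M $$ (a, b)) = 0" if "b < n" for b
    proof -
      have "vs ! b \<in> T" using that vs(3) by (auto simp: n_def intro: span_base)
      with ker have "inner \<xi> (A *v (vs ! b)) = 0" by blast
      then show ?thesis by (simp add: \<xi> inner_sum_left Mab that)
    qed
    have "c j = 0" if "j < n" for j
    proof -
      have MBj: "(\<Sum>b<n. M $$ (a, b) * B $$ (b, j)) = (if a = j then 1 else 0)" if a: "a < n" for a
      proof -
        have "(M * B) $$ (a, j) = (\<Sum>b<n. M $$ (a, b) * B $$ (b, j))"
          using a \<open>j < n\<close> M B by (auto simp: scalar_prod_def atLeast0LessThan)
        then show ?thesis using MB a \<open>j < n\<close> by simp
      qed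
      have "c j = (\<Sum>a<n. if a = j then c a else 0)"
        using that by simp
      also have "\<dots> = (\<Sum>a<n. c a * (if a = j then 1 else 0))"
        by (intro sum.cong) auto
      also have "\<dots> = (\<Sum>a<n. c a * (\<Sum>b<n. M $$ (a, b) * B $$ (b, j)))"
        by (intro sum.cong refl) (simp add: MBj)
      also have "\<dots> = (\<Sum>b<n. (\<Sum>a<n. c a * M $$ (a, b)) * B $$ (b, j))"
        unfolding sum_distrib_left sum_distrib_right
        by (subst sum.swap) (simp add: mult.assoc)
      also have "\<dots> = 0" by (simp add: cM)
      finally show ?thesis .
    qed
    then show "\<xi> = 0" by (simp add: \<xi>)
  qed
next
  assume *: "\<forall>\<xi>\<in>T. (\<forall>\<eta>\<in>T. inner \<xi> (A *v \<eta>) = 0) \<longrightarrow> \<xi> = 0"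
  obtain S where S: "S \<subseteq> T" "independent S" "T \<subseteq> span S"
    by (rule basis_exists[of T])
  then have "finite S" using independent_imp_finite by blast
  then obtain vs where vs: "set vs = S" "distinct vs"
    using finite_distinct_list by blast
  have span: "span (set vs) = T"
    using S vs assms by (simp add: span_minimal subset_antisym)
  define n where "n = length vs"
  define M where "M = restricted_mat A vs"
  have M: "M \<in> carrier_mat n n" by (simp add: M_def restricted_mat_def n_def)
  have Mab: "M $$ (a, b) = inner (vs ! a) (A *v (vs ! b))" if "a < n" "b < n" for a b
    using that by (simp add: M_def restricted_mat_def n_def)
  have "Determinant.det (transpose_mat M) \<noteq> 0"
  proof
    assume "Determinant.det (transpose_mat M) = 0"
    then obtain v where v: "v \<in> carrier_vec n" "v \<noteq> 0\<^sub>v n" "transpose_mat M *\<^sub>v v = 0\<^sub>v n"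
      using det_0_iff_vec_prod_zero[of "transpose_mat M" n] M by auto
    define \<xi> where "\<xi> = (\<Sum>a<n. vec_index v a *\<^sub>R vs ! a)"
    have zero: "inner \<xi> (A *v (vs ! b)) = 0" if "b < n" for b
    proof -
      have "0 = vec_index (transpose_mat M *\<^sub>v v) b" using v(3) that by simp
      also have "\<dots> = (\<Sum>a<n. M $$ (a, b) * vec_index v a)"
        using that M v(1) by (auto simp: scalar_prod_def atLeast0LessThan)
      also have "\<dots> = inner \<xi> (A *v (vs ! b))"
        by (simp add: \<xi>_def inner_sum_left Mab that mult.commute)
      finally show ?thesis by simp
    qed
    have \<xi>T: "\<xi> \<in> T"
      unfolding span[symmetric] span_set_list[OF vs(2)] by (auto simp: \<xi>_def n_def)
    have "inner \<xi> (A *v \<eta>) = 0" if "\<eta> \<in> T" for \<eta>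
    proof -
      from that obtain c where \<eta>: "\<eta> = (\<Sum>a<n. c a *\<^sub>R vs ! a)"
        unfolding span[symmetric] span_set_list[OF vs(2)] by (auto simp: n_def)
      show ?thesis
        unfolding \<eta> linear_sum[OF matrix_vector_mul_linear]
          linear_cmul[OF matrix_vector_mul_linear] inner_sum_right
        using zero by simp
    qed
    with * \<xi>T have "\<xi> = 0" by blast
    then have "vec_index v a = 0" if "a < n" for a
      using independent_list_coeffs_0[of vs "vec_index v" a] vs S(2) that
      by (simp add: \<xi>_def n_def)
    then have "v = 0\<^sub>v n" using v(1) by (intro eq_vecI) auto
    with v(2) show False by simp
  qed
  then have "Determinant.det M \<noteq> 0" using det_transpose[OF M] by simp
  from det_non_zero_imp_unit[OF M this, of "()"]
  have "invertible_mat M"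
    using M unfolding invertible_mat_def inverts_mat_def Units_def ring_mat_def by auto
  then show "nonsingular_on A T"
    unfolding nonsingular_on_def M_def using vs S span by blast
qed

text \<open>The derivative of the Karush-Kuhn-Tucker system with Hessian \<open>H\<close> and constraint gradients
  \<open>v p\<close>, \<open>p \<in> S\<close>. Multipliers are indexed by a subset \<open>S\<close> of the coordinates of \<open>\<real>\<^sup>n\<close>, which is
  possible because independent gradients number at most \<open>n\<close>; the superfluous coordinates are pinned
  to zero by the second component. So the system is a map from one Euclidean space to itself whatever
  the number of constraints is.\<close>

definition kkt_op ::
    "real ^ 'n::finite ^ 'n \<Rightarrow> 'n set \<Rightarrow> ('n \<Rightarrow> real ^ 'n) \<Rightarrow> (real ^ 'n) \<times> (real ^ 'n) \<Rightarrow>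
     (real ^ 'n) \<times> (real ^ 'n)" where
  "kkt_op H S v z =
     (fst z v* H - (\<Sum>p\<in>S. snd z $ p *\<^sub>R v p),
      \<chi> p. if p \<in> S then inner (v p) (fst z) else snd z $ p)"

lemma linear_kkt_op: "linear (kkt_op H S v)"
proof (rule linearI)
  show "kkt_op H S v (z + w) = kkt_op H S v z + kkt_op H S v w" for z w
    by (auto simp: kkt_op_def Finite_Cartesian_Product.vec_eq_iff vector_matrix_mult_def sum.distrib
        inner_add_right algebra_simps)
  show "kkt_op H S v (r *\<^sub>R z) = r *\<^sub>R kkt_op H S v z" for r z
    by (auto simp: kkt_op_def Finite_Cartesian_Product.vec_eq_iff vector_matrix_mult_def
        sum_distrib_left right_diff_distrib mult_ac)
qed

text \<open>A kernel element has a tangential first component \<open>\<xi>\<close>, and \<open>\<xi> v* H\<close> is a combination of constraint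
  gradients, hence orthogonal to the tangent space. So \<open>\<xi> = 0\<close> by nondegeneracy of the restricted
  form, and then the multipliers vanish by linear independence.\<close>

lemma inj_kkt_op:
  fixes H :: "real ^ 'n::finite ^ 'n"
  assumes indep: "\<And>u. (\<Sum>p\<in>S. u p *\<^sub>R v p) = 0 \<Longrightarrow> \<forall>p\<in>S. u p = 0"
    and nondeg: "\<And>\<xi>. (\<forall>p\<in>S. inner (v p) \<xi> = 0) \<Longrightarrow>
      (\<And>\<eta>. (\<forall>p\<in>S. inner (v p) \<eta> = 0) \<Longrightarrow> inner (\<xi> v* H) \<eta> = 0) \<Longrightarrow> \<xi> = 0"
  shows "inj (kkt_op H S v)"
proof (subst linear_injective_0[OF linear_kkt_op], intro allI impI)
  fix z assume z: "kkt_op H S v z = 0"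
  then have stat: "fst z v* H = (\<Sum>p\<in>S. snd z $ p *\<^sub>R v p)"
    and comp: "\<And>p. (if p \<in> S then inner (v p) (fst z) else snd z $ p) = 0"
    by (simp_all add: kkt_op_def prod_eq_iff Finite_Cartesian_Product.vec_eq_iff)
  have tan: "\<forall>p\<in>S. inner (v p) (fst z) = 0" using comp by metis
  have "fst z = 0"
    by (rule nondeg[OF tan]) (simp add: stat inner_sum_left)
  then have "\<forall>p\<in>S. snd z $ p = 0"
    using stat by (intro indep) simp
  then have "snd z = 0"
    using comp by (metis Finite_Cartesian_Product.vec_eq_iff zero_index)
  with \<open>fst z = 0\<close> show "z = 0" by (simp add: prod_eq_iff)
qed

section \<open>Zeros of almost linear maps\<close>

lemma almost_linear_unique_zero:
  fixes G T :: "'a::euclidean_space \<Rightarrow> 'a"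
  assumes "linear T" "m > 0" "\<And>w. m * norm w \<le> norm (T w)"
    and "\<And>z w. z \<in> B \<Longrightarrow> w \<in> B \<Longrightarrow> norm (G z - G w - T (z - w)) \<le> m / 2 * norm (z - w)"
    and "z \<in> B" "w \<in> B" "G z = 0" "G w = 0"
  shows "z = w"
proof -
  have "m * norm (z - w) \<le> m / 2 * norm (z - w)"
    using assms(3)[of "z - w"] assms(4)[of z w] assms(5-8) by simp
  with \<open>m > 0\<close> show ?thesis by simp
qed

text \<open>With \<open>R\<close> the inverse of \<open>T\<close>, the Newton-like map \<open>z \<mapsto> z - R (G z)\<close> is a contraction with constant
  \<open>1/2\<close>, and it maps the ball to itself because it moves the centre by at most half the radius.\<close>

lemma almost_linear_zero_exists:
  fixes G T :: "'a::euclidean_space \<Rightarrow> 'a"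
  assumes T: "linear T" and "m > 0" and lower: "\<And>w. m * norm w \<le> norm (T w)"
    and near: "\<And>z w. z \<in> cball a \<epsilon> \<Longrightarrow> w \<in> cball a \<epsilon> \<Longrightarrow>
      norm (G z - G w - T (z - w)) \<le> m / 2 * norm (z - w)"
    and small: "norm (G a) \<le> m / 2 * \<epsilon>" and "\<epsilon> > 0"
  shows "\<exists>z\<in>cball a \<epsilon>. G z = 0"
proof -
  have "inj T"
    unfolding linear_injective_0[OF T] using lower \<open>m > 0\<close>
    by (metis mult_le_0_iff norm_eq_zero norm_le_zero_iff not_less)
  then obtain R where R: "linear R" "\<And>w. T (R w) = w" "\<And>w. R (T w) = w"
    using linear_injective_isomorphism[OF T] by blast
  have Rle: "norm (R w) \<le> norm w / m" for w
    using lower[of "R w"] \<open>m > 0\<close> by (simp add: R(2) field_simps)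
  define \<Phi> where "\<Phi> z = z - R (G z)" for z
  have eq: "\<Phi> z - \<Phi> w = - R (G z - G w - T (z - w))" for z w
    using R(1) by (simp add: \<Phi>_def linear_diff R(3))
  have contr: "dist (\<Phi> z) (\<Phi> w) \<le> 1 / 2 * dist z w" if "z \<in> cball a \<epsilon>" "w \<in> cball a \<epsilon>" for z w
  proof -
    have "dist (\<Phi> z) (\<Phi> w) \<le> norm (G z - G w - T (z - w)) / m"
      unfolding dist_norm eq norm_minus_cancel by (rule Rle)
    also have "\<dots> \<le> (m / 2 * norm (z - w)) / m"
      using near[OF that] \<open>m > 0\<close> by (intro divide_right_mono) auto
    finally show ?thesis using \<open>m > 0\<close> by (simp add: dist_norm)
  qed
  have maps: "\<Phi> ` cball a \<epsilon> \<subseteq> cball a \<epsilon>"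
  proof (intro image_subsetI)
    fix z assume z: "z \<in> cball a \<epsilon>"
    have "dist a (\<Phi> z) \<le> dist a (\<Phi> a) + dist (\<Phi> a) (\<Phi> z)" by (rule dist_triangle)
    also have "dist a (\<Phi> a) \<le> \<epsilon> / 2"
      using order_trans[OF lower[of "R (G a)", unfolded R(2)] small] \<open>m > 0\<close>
      by (simp add: \<Phi>_def dist_norm)
    also have "dist (\<Phi> a) (\<Phi> z) \<le> \<epsilon> / 2"
      using contr[of a z] z \<open>\<epsilon> > 0\<close> by simp
    finally show "\<Phi> z \<in> cball a \<epsilon>" by simp
  qed
  have "\<exists>!z. z \<in> cball a \<epsilon> \<and> \<Phi> z = z"
    by (rule Banach_fix[of _ "1 / 2"]) (use maps contr \<open>\<epsilon> > 0\<close> in \<open>auto simp: complete_eq_closed\<close>)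
  then obtain z where z: "z \<in> cball a \<epsilon>" "R (G z) = 0" by (auto simp: \<Phi>_def)
  have "G z = 0" using R(2)[of "G z"] z(2) T by (simp add: linear_0)
  with z show ?thesis by blast
qed

section \<open>The Karush-Kuhn-Tucker map of an equality constrained program\<close>

definition kkt_map ::
    "(real ^ 'n::finite \<Rightarrow> real) \<Rightarrow> 'n set \<Rightarrow> ('n \<Rightarrow> real ^ 'n \<Rightarrow> real) \<Rightarrow> (real ^ 'n) \<times> (real ^ 'n) \<Rightarrow>
     (real ^ 'n) \<times> (real ^ 'n)" where
  "kkt_map f S c z =
     (gradient f (fst z) - (\<Sum>p\<in>S. snd z $ p *\<^sub>R gradient (c p) (fst z)),
      \<chi> p. if p \<in> S then c p (fst z) else snd z $ p)"

lemma norm_vector_matrix_mult_bound: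
  fixes H :: "real ^ 'n::finite ^ 'n"
  obtains B where "B > 0" "\<And>h. norm (h v* H) \<le> B * norm h"
proof -
  have "linear (\<lambda>h. h v* H)"
    by (rule linearI)
      (simp_all add: Finite_Cartesian_Product.vec_eq_iff vector_matrix_mult_def sum.distrib
        sum_distrib_left algebra_simps)
  then show ?thesis using linear_bounded_pos that by blast
qed

text \<open>The scalar \<open>s\<close> is a multiplier, whose range \<open>\<rho>\<close> is fixed before the radius \<open>d\<close>: the ball on
  which programs are compared must still be free to shrink once the range of the multipliers is
  known. The bilinear expression is split as
  \<open>s (\<nabla>\<psi> y - \<nabla>\<psi> z - (y - z) H) + (s - s0) (y - z) H + (s - t) (\<nabla>\<psi> z - \<nabla>\<phi> x)\<close>.\<close>

lemma eventually_scaled_gradient_almost_linear: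
  fixes \<phi> :: "real ^ 'n::finite \<Rightarrow> real"
  assumes \<phi>: "C2 \<phi>" and "\<kappa> > 0"
  shows "\<forall>\<^sub>F \<rho> in at_right 0. \<forall>\<^sub>F d in at_right 0. \<forall>\<psi>. C2_close d x \<phi> \<psi> \<longrightarrow>
    (\<forall>y\<in>cball x d. \<forall>z\<in>cball x d. \<forall>s\<in>cball s0 \<rho>. \<forall>t\<in>cball s0 \<rho>.
      norm (s *\<^sub>R gradient \<psi> y - t *\<^sub>R gradient \<psi> z -
        (s0 *\<^sub>R ((y - z) v* hessian \<phi> x) + (s - t) *\<^sub>R gradient \<phi> x))
      \<le> \<kappa> * (norm (y - z) + \<bar>s - t\<bar>))"
proof -
  obtain B where B: "B > 0" "\<And>h. norm (h v* hessian \<phi> x) \<le> B * norm h"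
    using norm_vector_matrix_mult_bound[of "hessian \<phi> x"] by metis
  define \<kappa>1 where "\<kappa>1 = \<kappa> / (2 * (\<bar>s0\<bar> + 1))"
  have \<kappa>1: "\<kappa>1 > 0" using \<open>\<kappa> > 0\<close> by (simp add: \<kappa>1_def add_nonneg_pos)
  have le1: "\<forall>\<^sub>F d in at_right (0::real). d \<le> 1" by (rule eventually_at_right_0_le) simp
  have \<kappa>B: "\<kappa> / (2 * B) > 0" using \<open>\<kappa> > 0\<close> B(1) by simp
  from eventually_at_right_0_le[OF \<kappa>B] le1
  show ?thesis
  proof eventually_elim
    case \<rho>: (elim \<rho>)
    from eventually_gradient_almost_affine[OF \<phi> \<kappa>1, of x] eventually_gradient_close[OF \<phi> \<open>\<kappa> > 0\<close>, of x]
    show ?case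
    proof (eventually_elim, intro allI impI ballI, goal_cases)
      case (1 d \<psi> y z s t)
      note elim = 1(1,2)
      have \<psi>: "C2_close d x \<phi> \<psi>" and yz: "y \<in> cball x d" "z \<in> cball x d"
        and st: "s \<in> cball s0 \<rho>" "t \<in> cball s0 \<rho>" using 1(3-) by auto
      have s: "\<bar>s - s0\<bar> \<le> \<rho>" using st(1) by (simp add: dist_real_def)
      have "norm (s *\<^sub>R (gradient \<psi> y - gradient \<psi> z - (y - z) v* hessian \<phi> x))
          \<le> (\<bar>s0\<bar> + 1) * (\<kappa>1 * norm (y - z))"
        unfolding norm_scaleR
        using elim(1) \<psi> yz s \<rho>(2) by (intro mult_mono) auto
      also have "\<dots> = \<kappa> / 2 * norm (y - z)"
        by (simp add: \<kappa>1_def field_simps)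
      finally have n1: "norm (s *\<^sub>R (gradient \<psi> y - gradient \<psi> z - (y - z) v* hessian \<phi> x))
          \<le> \<kappa> / 2 * norm (y - z)" .
      have "norm ((s - s0) *\<^sub>R ((y - z) v* hessian \<phi> x)) \<le> \<kappa> / (2 * B) * (B * norm (y - z))"
        unfolding norm_scaleR using s \<rho>(1) B \<kappa>B by (intro mult_mono) auto
      also have "\<dots> = \<kappa> / 2 * norm (y - z)" using B(1) by simp
      finally have 2: "norm ((s - s0) *\<^sub>R ((y - z) v* hessian \<phi> x)) \<le> \<kappa> / 2 * norm (y - z)" .
      have 3: "norm ((s - t) *\<^sub>R (gradient \<psi> z - gradient \<phi> x)) \<le> \<bar>s - t\<bar> * \<kappa>"
        unfolding norm_scaleR using elim(2) \<psi> yz(2) by (intro mult_left_mono) auto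
      have "s *\<^sub>R gradient \<psi> y - t *\<^sub>R gradient \<psi> z -
          (s0 *\<^sub>R ((y - z) v* hessian \<phi> x) + (s - t) *\<^sub>R gradient \<phi> x) =
          s *\<^sub>R (gradient \<psi> y - gradient \<psi> z - (y - z) v* hessian \<phi> x) +
          ((s - s0) *\<^sub>R ((y - z) v* hessian \<phi> x) + (s - t) *\<^sub>R (gradient \<psi> z - gradient \<phi> x))"
        by (simp add: algebra_simps)
      also have "norm \<dots> \<le> \<kappa> / 2 * norm (y - z) + (\<kappa> / 2 * norm (y - z) + \<bar>s - t\<bar> * \<kappa>)"
        by (intro order_trans[OF norm_triangle_ineq] add_mono n1 2 3)
      also have "\<dots> = \<kappa> * (norm (y - z) + \<bar>s - t\<bar>)" by (simp add: algebra_simps)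
      finally show ?case .
    qed
  qed
qed

lemma vector_matrix_mult_diff_sum:
  fixes H :: "real ^ 'n::finite ^ 'n"
  shows "h v* (H - (\<Sum>p\<in>S. a p *\<^sub>R K p)) = h v* H - (\<Sum>p\<in>S. a p *\<^sub>R (h v* K p))"
proof -
  have "(\<Sum>i\<in>UNIV. h $ i * (\<Sum>p\<in>S. a p * K p $ i $ j)) = (\<Sum>p\<in>S. a p * (\<Sum>i\<in>UNIV. h $ i * K p $ i $ j))" for j
    unfolding sum_distrib_left by (subst sum.swap) (simp add: mult_ac)
  then show ?thesis
    by (simp add: Finite_Cartesian_Product.vec_eq_iff vector_matrix_mult_def algebra_simps
        sum_subtractf)
qed

text \<open>Uniformly over all nearby programs, the Karush-Kuhn-Tucker map differs from its linearization at
  \<open>(x, \<nu>)\<close> by a map with a small Lipschitz constant. The \<open>1 + 3 n\<close> error terms are one for the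
  objective, two for each multiplier times gradient and one for each coordinate of the constraints.\<close>

lemma eventually_kkt_map_almost_linear:
  fixes f :: "real ^ 'n::finite \<Rightarrow> real"
  assumes f: "C2 f" and c: "\<And>p. p \<in> S \<Longrightarrow> C2 (c p)" and "\<kappa> > 0"
    and H: "H = hessian f x - (\<Sum>p\<in>S. \<nu> $ p *\<^sub>R hessian (c p) x)"
  shows "\<forall>\<^sub>F \<rho> in at_right 0. \<forall>\<^sub>F d in at_right 0.
    \<forall>f' c'. C2_close d x f f' \<and> (\<forall>p\<in>S. C2_close d x (c p) (c' p)) \<longrightarrow>
    (\<forall>z\<in>cball x d \<times> cball \<nu> \<rho>. \<forall>w\<in>cball x d \<times> cball \<nu> \<rho>.
      norm (kkt_map f' S c' z - kkt_map f' S c' w - kkt_op H S (\<lambda>p. gradient (c p) x) (z - w))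
      \<le> \<kappa> * norm (z - w))"
proof -
  define \<kappa>1 where "\<kappa>1 = \<kappa> / (1 + 3 * CARD('n))"
  have \<kappa>1: "\<kappa>1 > 0" using \<open>\<kappa> > 0\<close> by (simp add: \<kappa>1_def add_pos_nonneg)
  note ev_f = eventually_gradient_almost_affine[OF f \<kappa>1, of x]
  have ev_c: "\<forall>\<^sub>F \<rho> in at_right 0. \<forall>p\<in>S. \<forall>\<^sub>F d in at_right 0. \<forall>\<psi>. C2_close d x (c p) \<psi> \<longrightarrow>
    (\<forall>y\<in>cball x d. \<forall>z\<in>cball x d. \<forall>s\<in>cball (\<nu> $ p) \<rho>. \<forall>t\<in>cball (\<nu> $ p) \<rho>.
      norm (s *\<^sub>R gradient \<psi> y - t *\<^sub>R gradient \<psi> z -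
        (\<nu> $ p *\<^sub>R ((y - z) v* hessian (c p) x) + (s - t) *\<^sub>R gradient (c p) x))
      \<le> \<kappa>1 * (norm (y - z) + \<bar>s - t\<bar>))"
    using c \<kappa>1 by (intro eventually_ball_finite ballI eventually_scaled_gradient_almost_linear) auto
  have ev_v: "\<forall>\<^sub>F d in at_right 0. \<forall>p\<in>S. \<forall>\<psi>. C2_close d x (c p) \<psi> \<longrightarrow>
    (\<forall>y\<in>cball x d. \<forall>z\<in>cball x d.
      \<bar>\<psi> y - \<psi> z - inner (gradient (c p) x) (y - z)\<bar> \<le> \<kappa>1 * norm (y - z))"
    using c \<kappa>1 by (intro eventually_ball_finite ballI eventually_value_almost_affine) auto
  from ev_c show ?thesis
  proof eventually_elim
    case \<rho>: (elim \<rho>)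
    from ev_f eventually_ball_finite[OF _ \<rho>, OF finite] ev_v show ?case
    proof (eventually_elim, intro allI impI ballI, elim conjE, goal_cases)
      case (1 d f' c' z w)
      note elim = 1(1-3)
      have f': "C2_close d x f f'" and c': "\<forall>p\<in>S. C2_close d x (c p) (c' p)"
        and zw: "z \<in> cball x d \<times> cball \<nu> \<rho>" "w \<in> cball x d \<times> cball \<nu> \<rho>"
        using 1(4-) by auto
      define D where "D = norm (z - w)"
      have fst: "fst z \<in> cball x d" "fst w \<in> cball x d"
        using zw by (auto simp: mem_Times_iff)
      have snd: "snd z $ p \<in> cball (\<nu> $ p) \<rho>" "snd w $ p \<in> cball (\<nu> $ p) \<rho>" for p
        using zw dist_vec_nth_le[of \<nu> p "snd z"] dist_vec_nth_le[of \<nu> p "snd w"]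
        by (auto simp: mem_Times_iff)
      have Dfst: "norm (fst z - fst w) \<le> D"
        unfolding D_def using norm_fst_le[of "fst (z - w)" "snd (z - w)", unfolded prod.collapse]
        by simp
      have Dsnd: "\<bar>snd z $ p - snd w $ p\<bar> \<le> D" for p
        unfolding D_def using norm_snd_le[of "snd (z - w)" "fst (z - w)", unfolded prod.collapse] component_le_norm_cart[of "snd (z - w)" p] by simp
      let ?E = "kkt_map f' S c' z - kkt_map f' S c' w - kkt_op H S (\<lambda>p. gradient (c p) x) (z - w)"
      define e where "e p = snd z $ p *\<^sub>R gradient (c' p) (fst z) - snd w $ p *\<^sub>R gradient (c' p) (fst w) -
        (\<nu> $ p *\<^sub>R ((fst z - fst w) v* hessian (c p) x) + (snd z $ p - snd w $ p) *\<^sub>R gradient (c p) x)" for p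
      have e: "norm (e p) \<le> 2 * \<kappa>1 * D" if "p \<in> S" for p
      proof -
        have "norm (e p) \<le> \<kappa>1 * (norm (fst z - fst w) + \<bar>snd z $ p - snd w $ p\<bar>)"
          unfolding e_def using elim(2) that c' fst snd by blast
        also have "\<dots> \<le> \<kappa>1 * (D + D)"
          using \<kappa>1 Dfst Dsnd by (intro mult_left_mono add_mono) auto
        finally show ?thesis by simp
      qed
      have "fst ?E = (gradient f' (fst z) - gradient f' (fst w) - (fst z - fst w) v* hessian f x) - (\<Sum>p\<in>S. e p)"
      proof -
        define h where "h = fst z - fst w"
        have hH: "h v* H = h v* hessian f x - (\<Sum>p\<in>S. \<nu> $ p *\<^sub>R (h v* hessian (c p) x))"
          unfolding H by (rule vector_matrix_mult_diff_sum)
        have "fst ?E = gradient f' (fst z) - gradient f' (fst w) - h v* H -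
            (\<Sum>p\<in>S. snd z $ p *\<^sub>R gradient (c' p) (fst z) - snd w $ p *\<^sub>R gradient (c' p) (fst w) -
              (snd z $ p - snd w $ p) *\<^sub>R gradient (c p) x)"
          by (simp add: kkt_map_def kkt_op_def sum_subtractf h_def)
        also have "\<dots> = (gradient f' (fst z) - gradient f' (fst w) - h v* hessian f x) - (\<Sum>p\<in>S. e p)"
          unfolding hH e_def h_def[symmetric] by (simp add: sum_subtractf sum.distrib)
        finally show "fst ?E = (gradient f' (fst z) - gradient f' (fst w) - (fst z - fst w) v* hessian f x) -
            (\<Sum>p\<in>S. e p)"
          unfolding h_def .
      qed
      also have "norm \<dots> \<le> \<kappa>1 * D + CARD('n) * (2 * \<kappa>1 * D)"
      proof (rule order_trans[OF norm_triangle_ineq4], rule add_mono)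
        show "norm (gradient f' (fst z) - gradient f' (fst w) - (fst z - fst w) v* hessian f x) \<le> \<kappa>1 * D"
          using elim(1) f' fst order_trans[OF _ mult_left_mono[OF Dfst, of \<kappa>1]] \<kappa>1 by (auto simp: less_imp_le)
        have "norm (\<Sum>p\<in>S. e p) \<le> (\<Sum>p\<in>S. 2 * \<kappa>1 * D)"
          using e by (rule sum_norm_le)
        also have "\<dots> \<le> CARD('n) * (2 * \<kappa>1 * D)"
          using \<kappa>1 card_mono[of UNIV S] by (simp add: D_def mult_right_mono)
        finally show "norm (\<Sum>p\<in>S. e p) \<le> CARD('n) * (2 * \<kappa>1 * D)" .
      qed
      finally have n1: "norm (fst ?E) \<le> \<kappa>1 * D + CARD('n) * (2 * \<kappa>1 * D)" .
      have 2: "norm (snd ?E) \<le> CARD('n) * (\<kappa>1 * D)"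
      proof (rule norm_le_CARD_mult)
        fix p
        show "\<bar>snd ?E $ p\<bar> \<le> \<kappa>1 * D"
        proof (cases "p \<in> S")
          case True
          have "\<bar>c' p (fst z) - c' p (fst w) - inner (gradient (c p) x) (fst z - fst w)\<bar>
              \<le> \<kappa>1 * norm (fst z - fst w)"
            using elim(3) True c' fst by blast
          also have "\<dots> \<le> \<kappa>1 * D" using Dfst \<kappa>1 by simp
          finally show ?thesis using True by (simp add: kkt_map_def kkt_op_def)
        next
          case False
          then show ?thesis using \<kappa>1 by (simp add: kkt_map_def kkt_op_def D_def)
        qed
      qed
      have "norm ?E \<le> norm (fst ?E) + norm (snd ?E)"
        using norm_Pair_le[of "fst ?E" "snd ?E"] unfolding prod.collapse .
      also have "\<dots> \<le> \<kappa>1 * (1 + 3 * CARD('n)) * D"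
        using n1 2 by (simp add: algebra_simps)
      also have "\<dots> = \<kappa> * D" by (simp add: \<kappa>1_def add_pos_nonneg less_imp_neq[symmetric])
      finally show ?case by (simp add: D_def)
    qed
  qed
qed

lemma norm_sum_scaleR_le:
  fixes \<nu> :: "real ^ 'n::finite" and e :: "'n \<Rightarrow> 'a::real_normed_vector"
  assumes "\<And>p. p \<in> S \<Longrightarrow> norm (e p) \<le> a" "a \<ge> 0"
  shows "norm (\<Sum>p\<in>S. \<nu> $ p *\<^sub>R e p) \<le> CARD('n) * (norm \<nu> * a)"
proof -
  have "norm (\<Sum>p\<in>S. \<nu> $ p *\<^sub>R e p) \<le> (\<Sum>p\<in>S. norm \<nu> * a)"
    unfolding norm_scaleR[symmetric]
    by (rule sum_norm_le) (use assms component_le_norm_cart[of \<nu>] in \<open>auto intro!: mult_mono\<close>)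
  also have "\<dots> \<le> CARD('n) * (norm \<nu> * a)"
    using card_mono[of UNIV S] assms(2) by (simp add: mult_right_mono)
  finally show ?thesis .
qed

lemma eventually_kkt_map_small:
  fixes f :: "real ^ 'n::finite \<Rightarrow> real"
  assumes f: "C2 f" and c: "\<And>p. p \<in> S \<Longrightarrow> C2 (c p)" and "\<eta> > 0"
    and zero: "kkt_map f S c (x, \<nu>) = 0"
  shows "\<forall>\<^sub>F d in at_right 0. \<forall>f' c'. C2_close d x f f' \<and> (\<forall>p\<in>S. C2_close d x (c p) (c' p)) \<longrightarrow>
    norm (kkt_map f' S c' (x, \<nu>)) \<le> \<eta>"
proof -
  define \<kappa> where "\<kappa> = \<eta> / (1 + CARD('n) * norm \<nu> + CARD('n))"
  have pos: "1 + CARD('n) * norm \<nu> + CARD('n) > 0" by (simp add: add_pos_nonneg)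
  have \<kappa>: "\<kappa> > 0" using \<open>\<eta> > 0\<close> pos by (simp add: \<kappa>_def)
  note ev_f = eventually_gradient_close[OF f \<kappa>, of x]
  have ev_c: "\<forall>\<^sub>F d in at_right 0. \<forall>p\<in>S. \<forall>\<psi>. C2_close d x (c p) \<psi> \<longrightarrow> (\<forall>y\<in>cball x d.
    norm (gradient \<psi> y - gradient (c p) x) \<le> \<kappa>)"
    using c \<kappa> by (intro eventually_ball_finite ballI eventually_gradient_close) auto
  have ev_v: "\<forall>\<^sub>F d in at_right 0. \<forall>p\<in>S. \<forall>\<psi>. C2_close d x (c p) \<psi> \<longrightarrow> (\<forall>y\<in>cball x d.
    \<bar>\<psi> y - c p x\<bar> \<le> \<kappa>)"
  proof (intro eventually_ball_finite ballI)
    fix p assume "p \<in> S"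
    from eventually_C2_close[OF c[OF this] \<kappa>, of x]
    show "\<forall>\<^sub>F d in at_right 0. \<forall>\<psi>. C2_close d x (c p) \<psi> \<longrightarrow> (\<forall>y\<in>cball x d. \<bar>\<psi> y - c p x\<bar> \<le> \<kappa>)"
      by (rule eventually_mono) blast
  qed simp
  from ev_f ev_c ev_v eventually_at_right_less[of "0::real"] show ?thesis
  proof eventually_elim
    case (elim d)
    show ?case
    proof (intro allI impI, elim conjE)
      fix f' c'
      assume f': "C2_close d x f f'" and c': "\<forall>p\<in>S. C2_close d x (c p) (c' p)"
      have x: "x \<in> cball x d" using elim(4) by simp
      have stat: "gradient f x = (\<Sum>p\<in>S. \<nu> $ p *\<^sub>R gradient (c p) x)"
        and comp: "\<And>p. (if p \<in> S then c p x else \<nu> $ p) = 0"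
        using zero by (simp_all add: kkt_map_def prod_eq_iff Finite_Cartesian_Product.vec_eq_iff
            cong: if_cong)
      let ?E = "kkt_map f' S c' (x, \<nu>)"
      have "fst ?E = (gradient f' x - gradient f x) -
          (\<Sum>p\<in>S. \<nu> $ p *\<^sub>R (gradient (c' p) x - gradient (c p) x))"
        unfolding stat by (simp add: kkt_map_def sum_subtractf scaleR_diff_right)
      also have "norm \<dots> \<le> \<kappa> + CARD('n) * (norm \<nu> * \<kappa>)"
      proof (rule order_trans[OF norm_triangle_ineq4], rule add_mono)
        show "norm (gradient f' x - gradient f x) \<le> \<kappa>" using elim(1) f' x by blast
        show "norm (\<Sum>p\<in>S. \<nu> $ p *\<^sub>R (gradient (c' p) x - gradient (c p) x)) \<le> CARD('n) * (norm \<nu> * \<kappa>)"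
          by (rule norm_sum_scaleR_le) (use elim(2) c' x \<kappa> in auto)
      qed
      finally have 1: "norm (fst ?E) \<le> \<kappa> + CARD('n) * (norm \<nu> * \<kappa>)" .
      have 2: "norm (snd ?E) \<le> CARD('n) * \<kappa>"
      proof (rule norm_le_CARD_mult)
        fix p
        show "\<bar>snd ?E $ p\<bar> \<le> \<kappa>"
          using elim(3) c' x comp[of p] \<kappa> by (cases "p \<in> S") (fastforce simp: kkt_map_def)+
      qed
      have "norm ?E \<le> norm (fst ?E) + norm (snd ?E)"
        using norm_Pair_le[of "fst ?E" "snd ?E"] unfolding prod.collapse .
      also have "\<dots> \<le> \<kappa> * (1 + CARD('n) * norm \<nu> + CARD('n))"
        using 1 2 by (simp add: algebra_simps)
      also have "\<dots> = \<eta>" using pos by (simp add: \<kappa>_def)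
      finally show "norm ?E \<le> \<eta>" .
    qed
  qed
qed

text \<open>Let \<open>u = \<nu>' - \<nu>\<close>. The gradients \<open>g p\<close> of the original constraints satisfy
  \<open>\<Sum> u p g p = (\<nabla>f' y - \<nabla>f x) - \<Sum> \<nu>' p (\<nabla>c' p y - g p)\<close>, whose norm is at most
  \<open>\<kappa> (1 + n (|\<nu>| + |u|))\<close>. Independence bounds \<open>m |u|\<close> by the left-hand side, and the term with
  \<open>|u|\<close> on the right is absorbed because \<open>\<kappa> n \<le> m / 2\<close>.\<close>

lemma eventually_multipliers_close:
  fixes f :: "real ^ 'n::finite \<Rightarrow> real" and S :: "'n set"
  assumes f: "C2 f" and c: "\<And>p. p \<in> S \<Longrightarrow> C2 (c p)" and "\<eta> > 0" and "m > 0"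
    and lower: "\<And>u. (\<forall>p. p \<notin> S \<longrightarrow> u $ p = 0) \<Longrightarrow> m * norm u \<le> norm (\<Sum>p\<in>S. u $ p *\<^sub>R gradient (c p) x)"
    and stat: "gradient f x = (\<Sum>p\<in>S. \<nu> $ p *\<^sub>R gradient (c p) x)"
    and supp: "\<forall>p. p \<notin> S \<longrightarrow> \<nu> $ p = 0"
  shows "\<forall>\<^sub>F d in at_right 0. \<forall>f' c'. C2_close d x f f' \<and> (\<forall>p\<in>S. C2_close d x (c p) (c' p)) \<longrightarrow>
    (\<forall>y\<in>cball x d. \<forall>\<nu>'. (\<forall>p. p \<notin> S \<longrightarrow> \<nu>' $ p = 0) \<and>
      gradient f' y = (\<Sum>p\<in>S. \<nu>' $ p *\<^sub>R gradient (c' p) y) \<longrightarrow> norm (\<nu>' - \<nu>) \<le> \<eta>)"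
proof -
  define N where "N = 1 + CARD('n) * norm \<nu>"
  have N: "N > 0" by (simp add: N_def add_pos_nonneg)
  define \<kappa> where "\<kappa> = min (m / (2 * CARD('n))) (m * \<eta> / (2 * N))"
  have \<kappa>: "\<kappa> > 0" using \<open>\<eta> > 0\<close> \<open>m > 0\<close> N by (simp add: \<kappa>_def)
  have \<kappa>m: "CARD('n) * \<kappa> \<le> m / 2"
    using min.cobounded1[of "m / (2 * CARD('n))" "m * \<eta> / (2 * N)"] unfolding \<kappa>_def[symmetric]
    by (simp add: field_simps)
  have \<kappa>\<eta>: "\<kappa> * N \<le> m / 2 * \<eta>"
    using min.cobounded2[of "m / (2 * CARD('n))" "m * \<eta> / (2 * N)"] N unfolding \<kappa>_def[symmetric]
    by (simp add: field_simps)
  note ev_f = eventually_gradient_close[OF f \<kappa>, of x]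
  have ev_c: "\<forall>\<^sub>F d in at_right 0. \<forall>p\<in>S. \<forall>\<psi>. C2_close d x (c p) \<psi> \<longrightarrow> (\<forall>y\<in>cball x d.
    norm (gradient \<psi> y - gradient (c p) x) \<le> \<kappa>)"
    using c \<kappa> by (intro eventually_ball_finite ballI eventually_gradient_close) auto
  from ev_f ev_c show ?thesis
  proof eventually_elim
    case (elim d)
    show ?case
    proof (intro allI impI ballI, elim conjE)
      fix f' c' y \<nu>'
      assume f': "C2_close d x f f'" and c': "\<forall>p\<in>S. C2_close d x (c p) (c' p)"
        and y: "y \<in> cball x d" and supp': "\<forall>p. p \<notin> S \<longrightarrow> \<nu>' $ p = 0"
        and stat': "gradient f' y = (\<Sum>p\<in>S. \<nu>' $ p *\<^sub>R gradient (c' p) y)"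
      define u where "u = \<nu>' - \<nu>"
      have "(\<Sum>p\<in>S. u $ p *\<^sub>R gradient (c p) x) = (gradient f' y - gradient f x) -
          (\<Sum>p\<in>S. \<nu>' $ p *\<^sub>R (gradient (c' p) y - gradient (c p) x))"
        unfolding stat stat' u_def by (simp add: sum_subtractf algebra_simps)
      also have "norm \<dots> \<le> \<kappa> + CARD('n) * (norm \<nu>' * \<kappa>)"
      proof (rule order_trans[OF norm_triangle_ineq4], rule add_mono)
        show "norm (gradient f' y - gradient f x) \<le> \<kappa>" using elim(1) f' y by blast
        show "norm (\<Sum>p\<in>S. \<nu>' $ p *\<^sub>R (gradient (c' p) y - gradient (c p) x)) \<le> CARD('n) * (norm \<nu>' * \<kappa>)"
          by (rule norm_sum_scaleR_le) (use elim(2) c' y \<kappa> in auto)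
      qed
      also have "\<dots> \<le> \<kappa> + CARD('n) * ((norm \<nu> + norm u) * \<kappa>)"
        using norm_triangle_ineq[of \<nu> u] \<kappa>
        by (intro add_left_mono mult_left_mono mult_right_mono) (auto simp: u_def)
      also have "\<dots> = \<kappa> * N + CARD('n) * \<kappa> * norm u" by (simp add: N_def algebra_simps)
      also have "\<dots> \<le> m / 2 * \<eta> + m / 2 * norm u"
        by (intro add_mono mult_right_mono \<kappa>m \<kappa>\<eta>) simp
      finally have "m * norm u \<le> m / 2 * \<eta> + m / 2 * norm u"
        using lower[of u] supp supp' by (simp add: u_def)
      then have "m / 2 * norm u \<le> m / 2 * \<eta>" by simp
      then show "norm (\<nu>' - \<nu>) \<le> \<eta>" using \<open>m > 0\<close> by (simp add: u_def)
    qed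
  qed
qed

section \<open>W-stationarity in terms of constraint labels\<close>

definition labels :: "'i set \<Rightarrow> 'j set \<Rightarrow> nat \<Rightarrow> ('i, 'j) label set" where
  "labels I J k = Eq ` I \<union> Ineq ` J \<union> Sw1 ` {1..k} \<union> Sw2 ` {1..k}"

lemma labels_iff [simp]:
  "Eq i \<in> labels I J k \<longleftrightarrow> i \<in> I" "Ineq j \<in> labels I J k \<longleftrightarrow> j \<in> J"
  "Sw1 m \<in> labels I J k \<longleftrightarrow> m \<in> {1..k}" "Sw2 m \<in> labels I J k \<longleftrightarrow> m \<in> {1..k}"
  by (auto simp: labels_def)

lemma ball_labels:
  "(\<forall>c\<in>labels I J k. Q c) \<longleftrightarrow>
     (\<forall>i\<in>I. Q (Eq i)) \<and> (\<forall>j\<in>J. Q (Ineq j)) \<and> (\<forall>m\<in>{1..k}. Q (Sw1 m)) \<and> (\<forall>m\<in>{1..k}. Q (Sw2 m))"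
  by (auto simp: labels_def)

lemma finite_labels: "finite I \<Longrightarrow> finite J \<Longrightarrow> finite (labels I J k)"
  by (simp add: labels_def)

lemma sum_labels:
  fixes h :: "('i, 'j) label \<Rightarrow> 'a::comm_monoid_add"
  assumes "finite I" "finite J"
  shows "sum h (labels I J k) =
    (\<Sum>i\<in>I. h (Eq i)) + (\<Sum>j\<in>J. h (Ineq j)) + (\<Sum>m=1..k. h (Sw1 m) + h (Sw2 m))"
proof -
  have "sum h (labels I J k) = sum h (Eq ` I) + sum h (Ineq ` J) + sum h (Sw1 ` {1..k}) + sum h (Sw2 ` {1..k})"
    unfolding labels_def using assms by (subst sum.union_disjoint; auto)+
  then show ?thesis
    by (simp add: sum.reindex inj_on_def sum.distrib add.assoc)
qed

lemma components_eq: "components I J k P = insert (objf P) (constraint P ` labels I J k)"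
  by (auto simp: components_def labels_def image_Un image_image)

lemma C2_mpsc_iff:
  "C2_mpsc I J k P \<longleftrightarrow> C2 (objf P) \<and> (\<forall>c\<in>labels I J k. C2 (constraint P c))"
  by (simp add: C2_mpsc_def components_eq)

lemma constraint_mpsc_diff:
  "constraint (mpsc_diff P Q) c = (\<lambda>y. constraint P c y - constraint Q c y)"
  by (cases c) (simp_all add: mpsc_diff_def)

lemma C2_norm_mpsc_diff_le_iff:
  assumes fin: "finite I" "finite J" and P: "C2_mpsc I J k P" and Q: "C2_mpsc I J k Q" and "r \<ge> 0"
  shows "C2_norm (components I J k (mpsc_diff P Q)) (cball x r) \<le> \<delta> \<longleftrightarrow>
    C2_le (\<lambda>y. objf P y - objf Q y) (cball x r) \<delta> \<and>
    (\<forall>c\<in>labels I J k. C2_le (\<lambda>y. constraint P c y - constraint Q c y) (cball x r) \<delta>)"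
proof -
  have obj: "objf (mpsc_diff P Q) = (\<lambda>y. objf P y - objf Q y)" by (simp add: mpsc_diff_def)
  have "C2_norm (components I J k (mpsc_diff P Q)) (cball x r) \<le> \<delta> \<longleftrightarrow>
      (\<forall>\<phi>\<in>components I J k (mpsc_diff P Q). C2_le \<phi> (cball x r) \<delta>)"
  proof (rule C2_norm_le_iff)
    show "C2 \<phi>" if "\<phi> \<in> components I J k (mpsc_diff P Q)" for \<phi>
      using that P Q
      by (auto simp: components_eq constraint_mpsc_diff C2_mpsc_iff obj intro!: C2_diff)
  qed (use fin \<open>r \<ge> 0\<close> in \<open>auto simp: components_eq finite_labels\<close>)
  then show ?thesis by (simp add: components_eq constraint_mpsc_diff obj)
qed

lemma feasible_iff:
  "x \<in> feasible_set I J k P \<longleftrightarrow>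
     (\<forall>i\<in>I. constraint P (Eq i) x = 0) \<and> (\<forall>j\<in>J. constraint P (Ineq j) x \<ge> 0) \<and>
     (\<forall>m\<in>{1..k}. constraint P (Sw1 m) x = 0 \<or> constraint P (Sw2 m) x = 0)"
  by (simp add: feasible_set_def)

lemma active_eq:
  assumes "x \<in> feasible_set I J k P"
  shows "active I J k P x = {c \<in> labels I J k. constraint P c x = 0}"
  using assms
  unfolding active_def labels_def feasible_set_def J0_def \<alpha>_set_def \<beta>_set_def \<gamma>_set_def
  by (auto simp: image_iff)

lemma active_subset_labels: "active I J k P x \<subseteq> labels I J k"
  unfolding active_def labels_def J0_def \<alpha>_set_def \<beta>_set_def \<gamma>_set_def by auto

lemma tangent_space_eq:
  "tangent_space I J k P x =
     {\<xi>. \<forall>c\<in>active I J k P x. inner (gradient (constraint P c) x) \<xi> = 0}"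
  unfolding tangent_space_def active_def by (auto simp: ball_Un)

lemma subspace_tangent_space: "subspace (tangent_space I J k P x)"
  by (simp add: tangent_space_eq subspace_def inner_add_right)

lemma W_multipliers_iff:
  fixes lam :: "'i \<Rightarrow> real" and \<mu> :: "'j \<Rightarrow> real"
  assumes fin: "finite I" "finite J" and x: "x \<in> feasible_set I J k P"
    and \<Lambda>: "\<And>i. \<Lambda> (Eq i) = lam i" "\<And>j. \<Lambda> (Ineq j) = \<mu> j" "\<And>m. \<Lambda> (Sw1 m) = \<sigma>1 m" "\<And>m. \<Lambda> (Sw2 m) = \<sigma>2 m"
  shows "W_multipliers I J k P x lam \<mu> \<sigma>1 \<sigma>2 \<longleftrightarrow>
    gradient (objf P) x = (\<Sum>c\<in>active I J k P x. \<Lambda> c *\<^sub>R gradient (constraint P c) x) \<and>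
    (\<forall>c\<in>labels I J k - active I J k P x. \<Lambda> c = 0) \<and> (\<forall>j\<in>J. \<Lambda> (Ineq j) \<ge> 0)"
    (is "?L \<longleftrightarrow> ?stat \<and> ?comp \<and> ?pos")
proof -
  have comp: "(\<forall>j\<in>J. \<mu> j * ineqf P j x = 0 \<and> \<mu> j \<ge> 0) \<and>
     (\<forall>m\<in>{1..k}. \<sigma>1 m * F1 P m x = 0 \<and> \<sigma>2 m * F2 P m x = 0) \<longleftrightarrow> ?comp \<and> ?pos"
  proof -
    have "?comp \<longleftrightarrow> (\<forall>c\<in>labels I J k. constraint P c x \<noteq> 0 \<longrightarrow> \<Lambda> c = 0)"
      unfolding active_eq[OF x] by auto
    then show ?thesis
      using x unfolding ball_labels by (auto simp: \<Lambda> feasible_set_def)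
  qed
  have stat: "(\<Sum>i\<in>I. lam i *\<^sub>R gradient (eqf P i) x) + (\<Sum>j\<in>J. \<mu> j *\<^sub>R gradient (ineqf P j) x) +
       (\<Sum>m=1..k. \<sigma>1 m *\<^sub>R gradient (F1 P m) x + \<sigma>2 m *\<^sub>R gradient (F2 P m) x) =
       (\<Sum>c\<in>active I J k P x. \<Lambda> c *\<^sub>R gradient (constraint P c) x)" if ?comp
    using sum.mono_neutral_left[OF finite_labels[OF fin, of k] active_subset_labels,
        of P x "\<lambda>c. \<Lambda> c *\<^sub>R gradient (constraint P c) x"] that
    by (simp add: sum_labels[OF fin] \<Lambda>)
  show ?thesis
    unfolding W_multipliers_def using comp stat by auto
qed

text \<open>Complementarity makes the multipliers of inactive constraints vanish, so the combination of
  gradients reduces to the active constraints, and only the signs for active inequalities remain.\<close>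

lemma W_stationary_iff:
  fixes P :: "('n::finite, 'i, 'j) mpsc"
  assumes fin: "finite I" "finite J"
  shows "W_stationary I J k P x \<longleftrightarrow> x \<in> feasible_set I J k P \<and>
    (\<exists>\<Lambda>. gradient (objf P) x = (\<Sum>c\<in>active I J k P x. \<Lambda> c *\<^sub>R gradient (constraint P c) x) \<and>
      (\<forall>j\<in>J0 J P x. \<Lambda> (Ineq j) \<ge> 0))"
    (is "_ \<longleftrightarrow> _ \<and> ?R")
proof (cases "x \<in> feasible_set I J k P")
  case True
  note iff = W_multipliers_iff[OF fin True]
  have Ineq: "Ineq j \<in> active I J k P x \<longleftrightarrow> j \<in> J0 J P x" for j
    by (auto simp: active_def)
  have "(\<exists>lam \<mu> \<sigma>1 \<sigma>2. W_multipliers I J k P x lam \<mu> \<sigma>1 \<sigma>2) \<longleftrightarrow> ?R"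
  proof
    assume "\<exists>lam \<mu> \<sigma>1 \<sigma>2. W_multipliers I J k P x lam \<mu> \<sigma>1 \<sigma>2"
    then obtain lam \<mu> \<sigma>1 \<sigma>2 where W: "W_multipliers I J k P x lam \<mu> \<sigma>1 \<sigma>2" by blast
    show ?R
      using W unfolding iff[of "case_label lam \<mu> \<sigma>1 \<sigma>2" lam \<mu> \<sigma>1 \<sigma>2, simplified]
      by (intro exI[of _ "case_label lam \<mu> \<sigma>1 \<sigma>2"]) (auto simp: J0_def)
  next
    assume ?R
    then obtain \<Lambda> where \<Lambda>: "gradient (objf P) x = (\<Sum>c\<in>active I J k P x. \<Lambda> c *\<^sub>R gradient (constraint P c) x)"
      "\<forall>j\<in>J0 J P x. \<Lambda> (Ineq j) \<ge> 0" by blast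
    define \<Lambda>' where "\<Lambda>' c = (if c \<in> active I J k P x then \<Lambda> c else 0)" for c
    have "W_multipliers I J k P x (\<lambda>i. \<Lambda>' (Eq i)) (\<lambda>j. \<Lambda>' (Ineq j)) (\<lambda>m. \<Lambda>' (Sw1 m)) (\<lambda>m. \<Lambda>' (Sw2 m))"
      unfolding iff[of \<Lambda>', OF refl refl refl refl]
      using \<Lambda> by (auto simp: \<Lambda>'_def Ineq)
    then show "\<exists>lam \<mu> \<sigma>1 \<sigma>2. W_multipliers I J k P x lam \<mu> \<sigma>1 \<sigma>2" by blast
  qed
  with True show ?thesis by (simp add: W_stationary_def)
qed (simp add: W_stationary_def)

lemma lagrangian_eq:
  assumes "finite I" "finite J"
  shows "lagrangian I J k P lam \<mu> \<sigma>1 \<sigma>2 =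
    (\<lambda>y. objf P y - (\<Sum>c\<in>labels I J k. case_label lam \<mu> \<sigma>1 \<sigma>2 c * constraint P c y))"
  by (simp add: fun_eq_iff lagrangian_def sum_labels[OF assms])

lemma hessian_lagrangian:
  assumes f: "C2 f" and c: "\<And>p. p \<in> S \<Longrightarrow> C2 (c p)"
  shows "hessian (\<lambda>y. f y - (\<Sum>p\<in>S. a p * c p y)) x = hessian f x - (\<Sum>p\<in>S. a p *\<^sub>R hessian (c p) x)"
proof -
  have ac: "C2 (\<lambda>y. a p * c p y)" if "p \<in> S" for p using c[OF that] by (rule C2_cmult)
  have "partial_deriv q (\<lambda>y. f y - (\<Sum>p\<in>S. a p * c p y)) =
      (\<lambda>y. partial_deriv q f y - (\<Sum>p\<in>S. partial_deriv q (\<lambda>y. a p * c p y) y))" for q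
    using ac by (subst partial_deriv_diff) (auto intro: C2_imp_C1[OF f] C2_imp_C1[OF C2_sum] simp: partial_deriv_sum)
  then have 1: "partial_deriv q (\<lambda>y. f y - (\<Sum>p\<in>S. a p * c p y)) =
      (\<lambda>y. partial_deriv q f y - (\<Sum>p\<in>S. a p * partial_deriv q (c p) y))" for q
    using c by (simp add: partial_deriv_cmult[OF C2_imp_C1])
  have sumC1: "C1 (\<lambda>y. \<Sum>p\<in>S'. a p * partial_deriv q (c p) y) \<and>
      partial_deriv r (\<lambda>y. \<Sum>p\<in>S'. a p * partial_deriv q (c p) y) =
      (\<lambda>y. \<Sum>p\<in>S'. a p * partial_deriv r (partial_deriv q (c p)) y)" if "S' \<subseteq> S" for S' q r
    using that
  proof (induction S' rule: infinite_finite_induct)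
    case (insert p S')
    have p: "C1 (partial_deriv q (c p))" using insert.prems c by (simp add: C2_partial_C1)
    show ?case
      using insert p
      by (simp add: C1_add[OF C1_mult[OF C1_const p]] partial_deriv_add[OF C1_mult[OF C1_const p]]
          partial_deriv_cmult)
  qed (simp_all add: C1_const partial_deriv_const)
  show ?thesis
    using f sumC1[OF subset_refl]
    by (simp add: Finite_Cartesian_Product.vec_eq_iff hessian_def 1 partial_deriv_diff C2_partial_C1)
qed

section \<open>Enumeration of the active constraints\<close>

text \<open>Independent vectors in \<open>\<real>\<^sup>n\<close> number at most \<open>n\<close>, so the index type of the coordinates can also
  index the active constraints.\<close>

lemma LICQ_enumeration:
  fixes P :: "('n::finite, 'i, 'j) mpsc"
  assumes fin: "finite I" "finite J" and LICQ: "LICQ I J k P x"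
  obtains lab :: "'n \<Rightarrow> ('i, 'j) label" and S where "bij_betw lab S (active I J k P x)"
proof -
  let ?A = "active I J k P x" and ?g = "\<lambda>c. gradient (constraint P c) x"
  have "finite ?A"
    using finite_subset[OF active_subset_labels finite_labels[OF fin]] .
  moreover have "card ?A \<le> CARD('n)"
    using LICQ card_image[of ?g ?A] independent_bound[of "?g ` ?A"] by (simp add: LICQ_def)
  then obtain S :: "'n set" where "card S = card ?A"
    using obtain_subset_with_card_n[of "card ?A" "UNIV :: 'n set"] by auto
  ultimately obtain lab where "bij_betw lab S ?A"
    using finite_same_card_bij[of S ?A] by auto
  with that show thesis .
qed

lemma LICQ_coefficients:
  assumes LICQ: "LICQ I J k P x" and lab: "bij_betw lab S (active I J k P x)"
    and fin: "finite I" "finite J"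
    and zero: "(\<Sum>p\<in>S. u p *\<^sub>R gradient (constraint P (lab p)) x) = 0"
  shows "\<forall>p\<in>S. u p = 0"
proof
  fix p assume p: "p \<in> S"
  let ?A = "active I J k P x" and ?g = "\<lambda>c. gradient (constraint P c) x"
  have fA: "finite ?A"
    using finite_subset[OF active_subset_labels finite_labels[OF fin]] .
  have bij: "bij_betw (\<lambda>p. ?g (lab p)) S (?g ` ?A)"
    using bij_betw_trans[OF lab inj_on_imp_bij_betw[of ?g ?A]] LICQ by (simp add: LICQ_def comp_def)
  define U where "U w = u (inv_into S (\<lambda>p. ?g (lab p)) w)" for w
  have U: "U (?g (lab q)) = u q" if "q \<in> S" for q
    using bij_betw_inv_into_left[OF bij that] by (simp add: U_def)
  have "(\<Sum>w\<in>?g ` ?A. U w *\<^sub>R w) = (\<Sum>p\<in>S. U (?g (lab p)) *\<^sub>R ?g (lab p))"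
    using sum.reindex_bij_betw[OF bij, of "\<lambda>w. U w *\<^sub>R w"] by simp
  also have "\<dots> = 0" using zero U by simp
  finally have "U (?g (lab p)) = 0"
    using independentD[of "?g ` ?A" "?g ` ?A" U "?g (lab p)"] LICQ fA bij_betwE[OF lab] p
    by (simp add: LICQ_def)
  with U[OF p] show "u p = 0" by simp
qed

section \<open>Nondegeneracy implies strong stability\<close>

lemma eventually_at_right_0_obtain:
  "\<forall>\<^sub>F d in at_right (0::real). Q d \<Longrightarrow> \<exists>d>0. Q d"
  unfolding eventually_at_right_field using dense by blast

lemma C2_le_subset: "C2_le \<phi> B M \<Longrightarrow> B' \<subseteq> B \<Longrightarrow> C2_le \<phi> B' M"
  unfolding C2_le_def by blast

lemma C2_closeI:
  assumes "C2 \<psi>" "C2_le (\<lambda>y. \<phi> y - \<psi> y) (cball x r) \<delta>" "\<delta> \<le> d" "d \<le> r"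
  shows "C2_close d x \<phi> \<psi>"
  unfolding C2_close_def
  using assms C2_le_mono[OF C2_le_subset[OF assms(2)], of "cball x d" d] subset_cball[of d r x] by auto

lemma hessian_lagrangian_active:
  assumes fin: "finite I" "finite J" and P: "C2_mpsc I J k P"
    and supp: "\<forall>c\<in>labels I J k - active I J k P x. case_label lam \<mu> \<sigma>1 \<sigma>2 c = 0"
  shows "hessian (lagrangian I J k P lam \<mu> \<sigma>1 \<sigma>2) x =
    hessian (objf P) x -
      (\<Sum>c\<in>active I J k P x. case_label lam \<mu> \<sigma>1 \<sigma>2 c *\<^sub>R hessian (constraint P c) x)"
proof -
  have "(\<Sum>c\<in>active I J k P x. case_label lam \<mu> \<sigma>1 \<sigma>2 c *\<^sub>R hessian (constraint P c) x) =
      (\<Sum>c\<in>labels I J k. case_label lam \<mu> \<sigma>1 \<sigma>2 c *\<^sub>R hessian (constraint P c) x)"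
    using supp by (intro sum.mono_neutral_left active_subset_labels finite_labels fin) auto
  then show ?thesis
    using P unfolding lagrangian_eq[OF fin]
    by (subst hessian_lagrangian) (auto simp: C2_mpsc_iff)
qed

lemma inj_kkt_op_active:
  fixes P :: "('n::finite, 'i, 'j) mpsc"
  assumes fin: "finite I" "finite J" and LICQ: "LICQ I J k P x"
    and lab: "bij_betw lab S (active I J k P x)"
    and H: "nonsingular_on H (tangent_space I J k P x)"
  shows "inj (kkt_op H S (\<lambda>p. gradient (constraint P (lab p)) x))"
proof (rule inj_kkt_op)
  show "\<forall>p\<in>S. u p = 0" if "(\<Sum>p\<in>S. u p *\<^sub>R gradient (constraint P (lab p)) x) = 0" for u
    using LICQ_coefficients[OF LICQ lab fin that] .
  have T: "\<xi> \<in> tangent_space I J k P x \<longleftrightarrow> (\<forall>p\<in>S. inner (gradient (constraint P (lab p)) x) \<xi> = 0)" for \<xi>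
    unfolding tangent_space_eq bij_betw_imp_surj_on[OF lab, symmetric] by auto
  show "\<xi> = 0" if "\<forall>p\<in>S. inner (gradient (constraint P (lab p)) x) \<xi> = 0"
    "\<And>\<eta>. \<forall>p\<in>S. inner (gradient (constraint P (lab p)) x) \<eta> = 0 \<Longrightarrow> inner (\<xi> v* H) \<eta> = 0" for \<xi>
    using H that unfolding nonsingular_on_iff[OF subspace_tangent_space]
    by (simp add: T dot_lmul_matrix)
qed

lemma eventually_inactive_keep_sign:
  fixes P :: "('n::finite, 'i, 'j) mpsc"
  assumes fin: "finite I" "finite J" and P: "C2_mpsc I J k P"
  shows "\<forall>\<^sub>F d in at_right 0. \<forall>c\<in>{c\<in>labels I J k. constraint P c x \<noteq> 0}.
    \<forall>\<psi>. C2_close d x (constraint P c) \<psi> \<longrightarrow> (\<forall>y\<in>cball x d. sgn (\<psi> y) = sgn (constraint P c x))"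
proof (intro eventually_ball_finite ballI)
  show "finite {c\<in>labels I J k. constraint P c x \<noteq> 0}" using fin by (simp add: finite_labels)
  fix c assume c: "c \<in> {c\<in>labels I J k. constraint P c x \<noteq> 0}"
  have "C2 (constraint P c)" "\<bar>constraint P c x\<bar> / 2 > 0" using c P by (auto simp: C2_mpsc_iff)
  from eventually_C2_close[OF this, of x]
  show "\<forall>\<^sub>F d in at_right 0. \<forall>\<psi>. C2_close d x (constraint P c) \<psi> \<longrightarrow>
      (\<forall>y\<in>cball x d. sgn (\<psi> y) = sgn (constraint P c x))"
  proof eventually_elim
    case (elim d)
    show ?case
    proof (intro allI impI ballI)
      fix \<psi> y assume "C2_close d x (constraint P c) \<psi>" "y \<in> cball x d"
      with elim have "\<bar>\<psi> y - constraint P c x\<bar> \<le> \<bar>constraint P c x\<bar> / 2" by blast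
      then show "sgn (\<psi> y) = sgn (constraint P c x)"
        using c by (auto simp: sgn_if abs_if split: if_splits)
    qed
  qed
qed

text \<open>A zero is feasible since from each switching pair at least one function is active at \<open>x\<close> and
  therefore among the functions that vanish at \<open>y\<close>.\<close>

lemma kkt_zero_imp_W_stationary:
  fixes Q :: "('n::finite, 'i, 'j) mpsc"
  assumes fin: "finite I" "finite J" and feas: "x \<in> feasible_set I J k P"
    and lab: "bij_betw lab S (active I J k P x)"
    and pos: "\<forall>j\<in>J. ineqf Q j y > 0"
    and inact: "\<forall>c\<in>labels I J k - active I J k P x. constraint Q c y \<noteq> 0"
    and zero: "kkt_map (objf Q) S (\<lambda>p. constraint Q (lab p)) (y, u) = 0"
  shows "W_stationary I J k Q y"
proof -
  let ?A = "active I J k P x"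
  have stat: "gradient (objf Q) y = (\<Sum>p\<in>S. u $ p *\<^sub>R gradient (constraint Q (lab p)) y)"
    and comp: "\<And>p. (if p \<in> S then constraint Q (lab p) y else u $ p) = 0"
    using zero by (simp_all add: kkt_map_def prod_eq_iff Finite_Cartesian_Product.vec_eq_iff cong: if_cong)
  have act: "constraint Q c y = 0" if "c \<in> ?A" for c
    using that comp bij_betw_imp_surj_on[OF lab] by (metis imageE)
  have "y \<in> feasible_set I J k Q"
    unfolding feasible_iff
  proof (intro conjI ballI)
    show "constraint Q (Eq i) y = 0" if "i \<in> I" for i
      using that by (intro act) (simp add: active_def)
    show "constraint Q (Ineq j) y \<ge> 0" if "j \<in> J" for j
      using pos that by (simp add: less_imp_le)
    show "constraint Q (Sw1 m) y = 0 \<or> constraint Q (Sw2 m) y = 0" if "m \<in> {1..k}" for m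
    proof -
      have "Sw1 m \<in> ?A \<or> Sw2 m \<in> ?A"
        using feas that unfolding active_eq[OF feas] by (auto simp: feasible_iff)
      then show ?thesis using act by blast
    qed
  qed
  moreover from this have "active I J k Q y = ?A"
    using act inact active_subset_labels[of I J k P x] by (auto simp: active_eq)
  moreover have "J0 J Q y = {}" using pos by (auto simp: J0_def)
  moreover have "gradient (objf Q) y = (\<Sum>c\<in>?A. u $ inv_into S lab c *\<^sub>R gradient (constraint Q c) y)"
    unfolding stat sum.reindex_bij_betw[OF lab, symmetric]
    using bij_betw_inv_into_left[OF lab] by simp
  ultimately show ?thesis unfolding W_stationary_iff[OF fin] by auto
qed

text \<open>The point is to show that no constraint active at \<open>x\<close> becomes inactive at \<open>y\<close>. In a pair with
  just one function vanishing at \<open>x\<close>, the other one stays nonzero, so switching forces the first one to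
  vanish at \<open>y\<close>. In a biactive pair both multipliers stay nonzero, so complementarity forces both
  functions to vanish.\<close>

lemma W_stationary_imp_kkt_zero:
  fixes Q :: "('n::finite, 'i, 'j) mpsc" and \<nu> :: "real ^ 'n"
  assumes fin: "finite I" "finite J" and feas: "x \<in> feasible_set I J k P" and "J0 J P x = {}"
    and lab: "bij_betw lab S (active I J k P x)"
    and inact: "\<forall>c\<in>labels I J k - active I J k P x. constraint Q c y \<noteq> 0"
    and W: "W_stationary I J k Q y"
    and close: "\<And>u. (\<forall>p. p \<notin> S \<longrightarrow> u $ p = 0) \<Longrightarrow>
      gradient (objf Q) y = (\<Sum>p\<in>S. u $ p *\<^sub>R gradient (constraint Q (lab p)) y) \<Longrightarrow> norm (u - \<nu>) \<le> \<eta>"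
    and big: "\<And>p m. p \<in> S \<Longrightarrow> m \<in> \<beta>_set k P x \<Longrightarrow> lab p = Sw1 m \<or> lab p = Sw2 m \<Longrightarrow> \<eta> < \<bar>\<nu> $ p\<bar>"
  obtains u where "kkt_map (objf Q) S (\<lambda>p. constraint Q (lab p)) (y, u) = 0" "norm (u - \<nu>) \<le> \<eta>"
proof -
  let ?A = "active I J k P x" and ?A' = "active I J k Q y"
  from W obtain \<Lambda> where feas': "y \<in> feasible_set I J k Q"
    and \<Lambda>: "gradient (objf Q) y = (\<Sum>c\<in>?A'. \<Lambda> c *\<^sub>R gradient (constraint Q c) y)"
    unfolding W_stationary_iff[OF fin] by blast
  have fA: "finite ?A"
    using finite_subset[OF active_subset_labels finite_labels[OF fin]] .
  have sub: "?A' \<subseteq> ?A" using inact by (auto simp: active_eq[OF feas'])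
  define u where "u = (\<chi> p. if p \<in> S \<and> lab p \<in> ?A' then \<Lambda> (lab p) else 0)"
  have "gradient (objf Q) y = (\<Sum>c\<in>?A. (if c \<in> ?A' then \<Lambda> c else 0) *\<^sub>R gradient (constraint Q c) y)"
    unfolding \<Lambda> using sub fA by (intro sum.mono_neutral_cong_left) auto
  also have "\<dots> = (\<Sum>p\<in>S. u $ p *\<^sub>R gradient (constraint Q (lab p)) y)"
    unfolding sum.reindex_bij_betw[OF lab, symmetric] by (intro sum.cong) (auto simp: u_def)
  finally have stat: "gradient (objf Q) y = (\<Sum>p\<in>S. u $ p *\<^sub>R gradient (constraint Q (lab p)) y)" .
  have norm: "norm (u - \<nu>) \<le> \<eta>"
    by (rule close[OF _ stat]) (simp add: u_def)
  have zero: "constraint Q c y = 0" if c: "c \<in> ?A" for c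
  proof -
    have beta: "constraint Q c y = 0" if m: "m \<in> \<beta>_set k P x" and c_m: "c = Sw1 m \<or> c = Sw2 m" for m
    proof -
      have "c \<in> lab ` S" using c by (simp only: bij_betw_imp_surj_on[OF lab])
      then obtain p where p: "p \<in> S" "lab p = c" by auto
      have "\<eta> < \<bar>\<nu> $ p\<bar>" using c_m by (intro big[OF p(1) m]) (simp add: p(2))
      then have "\<bar>(u - \<nu>) $ p\<bar> < \<bar>\<nu> $ p\<bar>"
        using component_le_norm_cart[of "u - \<nu>" p] norm by linarith
      then have "u $ p \<noteq> 0" by auto
      then show ?thesis using p by (auto simp: u_def active_eq[OF feas'] split: if_splits)
    qed
    have c': "c \<in> labels I J k" "constraint P c x = 0" using c by (auto simp: active_eq[OF feas])
    have inact': "constraint Q d y \<noteq> 0" if "d \<in> labels I J k" "constraint P d x \<noteq> 0" for d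
      using inact that by (simp add: active_eq[OF feas])
    show ?thesis
    proof (cases c)
      case (Eq i)
      then show ?thesis using feas' c' by (simp add: feasible_iff)
    next
      case (Ineq j)
      then show ?thesis using c' \<open>J0 J P x = {}\<close> by (auto simp: J0_def)
    next
      case (Sw1 m)
      show ?thesis
      proof (cases "constraint P (Sw2 m) x = 0")
        case True
        then show ?thesis using Sw1 c' by (intro beta[of m]) (auto simp: \<beta>_set_def)
      next
        case False
        then have "constraint Q (Sw2 m) y \<noteq> 0" using Sw1 c' by (intro inact') simp_all
        then show ?thesis using feas' Sw1 c' by (auto simp: feasible_iff)
      qed
    next
      case (Sw2 m)
      show ?thesis
      proof (cases "constraint P (Sw1 m) x = 0")
        case True
        then show ?thesis using Sw2 c' by (intro beta[of m]) (auto simp: \<beta>_set_def)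
      next
        case False
        then have "constraint Q (Sw1 m) y \<noteq> 0" using Sw2 c' by (intro inact') simp_all
        then show ?thesis using feas' Sw2 c' by (auto simp: feasible_iff)
      qed
    qed
  qed
  have "kkt_map (objf Q) S (\<lambda>p. constraint Q (lab p)) (y, u) = 0"
    using zero bij_betwE[OF lab] stat
    by (auto simp: kkt_map_def prod_eq_iff Finite_Cartesian_Product.vec_eq_iff u_def)
  from that[OF this norm] show thesis .
qed

text \<open>The constants are chosen in this order: \<open>m\<close> from the injective linearization, the range \<open>\<rho>\<close> of
  the multipliers from the Lipschitz estimate, the distance \<open>\<eta> \<le> \<rho>\<close> below which nonzero multipliers
  stay nonzero, the radius \<open>r\<close> of the ball, and for each \<open>\<epsilon>\<close> the tolerance \<open>\<delta>\<close>, which makes the residual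
  at \<open>(x, \<nu>)\<close> so small that the zero lies within \<open>\<epsilon>\<close>.\<close>

lemma nondegenerate_imp_strongly_stable:
  fixes P :: "('n::finite, 'i, 'j) mpsc"
  assumes fin: "finite I" "finite J" and P: "C2_mpsc I J k P"
    and W: "W_stationary I J k P x" and J0: "J0 J P x = {}" and nd: "nondegenerate I J k P x"
  shows "strongly_stable I J k P x"
proof -
  let ?A = "active I J k P x"
  from nd obtain lam \<mu> \<sigma>1 \<sigma>2 where feas: "x \<in> feasible_set I J k P"
    and mult: "W_multipliers I J k P x lam \<mu> \<sigma>1 \<sigma>2" and LICQ: "LICQ I J k P x"
    and ND3: "\<forall>m\<in>\<beta>_set k P x. \<sigma>1 m * \<sigma>2 m \<noteq> 0"
    and ND4: "nonsingular_on (hessian (lagrangian I J k P lam \<mu> \<sigma>1 \<sigma>2) x) (tangent_space I J k P x)"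
    unfolding nondegenerate_def by blast
  define \<Lambda> where "\<Lambda> = case_label lam \<mu> \<sigma>1 \<sigma>2"
  have stat: "gradient (objf P) x = (\<Sum>c\<in>?A. \<Lambda> c *\<^sub>R gradient (constraint P c) x)"
    and supp: "\<forall>c\<in>labels I J k - ?A. \<Lambda> c = 0"
    using mult W_multipliers_iff[OF fin feas, of \<Lambda> lam \<mu> \<sigma>1 \<sigma>2] by (auto simp: \<Lambda>_def)
  obtain lab :: "'n \<Rightarrow> ('i, 'j) label" and S where lab: "bij_betw lab S ?A"
    using LICQ_enumeration[OF fin LICQ] .
  have labA: "lab p \<in> labels I J k" "constraint P (lab p) x = 0" if "p \<in> S" for p
    using bij_betwE[OF lab] that by (auto simp: active_eq[OF feas])
  define c where "c p = constraint P (lab p)" for p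
  define \<nu> where "\<nu> = (\<chi> p. if p \<in> S then \<Lambda> (lab p) else 0)"
  define H where "H = hessian (objf P) x - (\<Sum>p\<in>S. \<nu> $ p *\<^sub>R hessian (c p) x)"
  define T where "T = kkt_op H S (\<lambda>p. gradient (c p) x)"
  have f: "C2 (objf P)" and cC2: "\<And>p. p \<in> S \<Longrightarrow> C2 (c p)"
    using P labA by (auto simp: C2_mpsc_iff c_def)
  have "hessian (lagrangian I J k P lam \<mu> \<sigma>1 \<sigma>2) x = H"
    unfolding hessian_lagrangian_active[OF fin P supp[unfolded \<Lambda>_def]] H_def \<Lambda>_def[symmetric]
      sum.reindex_bij_betw[OF lab, symmetric] by (simp add: \<nu>_def c_def)
  then have "inj T"
    using inj_kkt_op_active[OF fin LICQ lab ND4] by (simp add: T_def c_def)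
  moreover have linT: "linear T" unfolding T_def by (rule linear_kkt_op)
  ultimately obtain m where m: "m > 0" "\<And>w. m * norm w \<le> norm (T w)"
    using linear_inj_bounded_below_pos by blast
  have stat\<nu>: "gradient (objf P) x = (\<Sum>p\<in>S. \<nu> $ p *\<^sub>R gradient (c p) x)"
    unfolding stat sum.reindex_bij_betw[OF lab, symmetric] by (simp add: \<nu>_def c_def)
  have supp\<nu>: "\<forall>p. p \<notin> S \<longrightarrow> \<nu> $ p = 0" by (simp add: \<nu>_def)
  have zero: "kkt_map (objf P) S c (x, \<nu>) = 0"
    using stat\<nu> labA by (simp add: kkt_map_def prod_eq_iff Finite_Cartesian_Product.vec_eq_iff c_def \<nu>_def)
  have lower: "m * norm u \<le> norm (\<Sum>p\<in>S. u $ p *\<^sub>R gradient (c p) x)" if "\<forall>p. p \<notin> S \<longrightarrow> u $ p = 0" for u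
  proof -
    have "T (0, u) = (- (\<Sum>p\<in>S. u $ p *\<^sub>R gradient (c p) x), 0)"
      using that by (auto simp: T_def kkt_op_def Finite_Cartesian_Product.vec_eq_iff)
    then show ?thesis using m(2)[of "(0, u)"] by (simp add: norm_Pair)
  qed
  have m2: "m / 2 > 0" using m by simp
  have "\<forall>\<^sub>F \<rho> in at_right (0::real). \<rho> > 0" by (rule eventually_at_right_less)
  with eventually_kkt_map_almost_linear[OF f cC2 m2 H_def]
  have "\<exists>\<rho>>0. \<forall>\<^sub>F d in at_right 0. \<forall>f' c'. C2_close d x (objf P) f' \<and> (\<forall>p\<in>S. C2_close d x (c p) (c' p)) \<longrightarrow>
    (\<forall>z\<in>cball x d \<times> cball \<nu> \<rho>. \<forall>w\<in>cball x d \<times> cball \<nu> \<rho>.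
      norm (kkt_map f' S c' z - kkt_map f' S c' w - T (z - w)) \<le> m / 2 * norm (z - w))"
    unfolding T_def by (intro eventually_happens'[OF _ eventually_conj]) auto
  then obtain \<rho> where "\<rho> > 0" and almost: "\<forall>\<^sub>F d in at_right 0. \<forall>f' c'.
      C2_close d x (objf P) f' \<and> (\<forall>p\<in>S. C2_close d x (c p) (c' p)) \<longrightarrow>
    (\<forall>z\<in>cball x d \<times> cball \<nu> \<rho>. \<forall>w\<in>cball x d \<times> cball \<nu> \<rho>.
      norm (kkt_map f' S c' z - kkt_map f' S c' w - T (z - w)) \<le> m / 2 * norm (z - w))"
    by blast
  \<comment> \<open>The halves make the inequality \<open>\<eta> < \<bar>\<nu> $ p\<bar>\<close> strict.\<close>
  define \<eta> where "\<eta> = Min (insert \<rho> ((\<lambda>p. \<bar>\<nu> $ p\<bar> / 2) ` {p. \<nu> $ p \<noteq> 0}))"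
  have "\<eta> > 0" using \<open>\<rho> > 0\<close> by (simp add: \<eta>_def)
  have "\<eta> \<le> \<rho>" by (simp add: \<eta>_def)
  have \<eta>\<nu>: "\<eta> < \<bar>\<nu> $ p\<bar>" if "\<nu> $ p \<noteq> 0" for p
  proof -
    have "\<eta> \<le> \<bar>\<nu> $ p\<bar> / 2" unfolding \<eta>_def using that by (intro Min_le) auto
    with that show ?thesis by simp
  qed
  have mclose: "\<forall>\<^sub>F d in at_right 0. \<forall>f' c'. C2_close d x (objf P) f' \<and> (\<forall>p\<in>S. C2_close d x (c p) (c' p)) \<longrightarrow>
    (\<forall>y\<in>cball x d. \<forall>u. (\<forall>p. p \<notin> S \<longrightarrow> u $ p = 0) \<and>
      gradient f' y = (\<Sum>p\<in>S. u $ p *\<^sub>R gradient (c' p) y) \<longrightarrow> norm (u - \<nu>) \<le> \<eta>)"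
    using lower by (intro eventually_multipliers_close[OF f cC2 \<open>\<eta> > 0\<close> m(1) _ stat\<nu> supp\<nu>]) auto
  from eventually_at_right_0_obtain[OF eventually_conj[OF almost eventually_conj[OF mclose
        eventually_inactive_keep_sign[OF fin P, of x]]]]
  obtain r where "r > 0"
    and almost: "\<And>f' c' z w. C2_close r x (objf P) f' \<Longrightarrow> (\<forall>p\<in>S. C2_close r x (c p) (c' p)) \<Longrightarrow>
      z \<in> cball x r \<times> cball \<nu> \<rho> \<Longrightarrow> w \<in> cball x r \<times> cball \<nu> \<rho> \<Longrightarrow>
      norm (kkt_map f' S c' z - kkt_map f' S c' w - T (z - w)) \<le> m / 2 * norm (z - w)"
    and mclose: "\<And>f' c' y u. C2_close r x (objf P) f' \<Longrightarrow> (\<forall>p\<in>S. C2_close r x (c p) (c' p)) \<Longrightarrow>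
      y \<in> cball x r \<Longrightarrow> (\<forall>p. p \<notin> S \<longrightarrow> u $ p = 0) \<Longrightarrow>
      gradient f' y = (\<Sum>p\<in>S. u $ p *\<^sub>R gradient (c' p) y) \<Longrightarrow> norm (u - \<nu>) \<le> \<eta>"
    and sign: "\<And>l \<psi> y. l \<in> labels I J k \<Longrightarrow> constraint P l x \<noteq> 0 \<Longrightarrow>
      C2_close r x (constraint P l) \<psi> \<Longrightarrow> y \<in> cball x r \<Longrightarrow> sgn (\<psi> y) = sgn (constraint P l x)"
    by atomize_elim (erule ex_forward, elim conjE, intro conjI; blast)
  show ?thesis
    unfolding strongly_stable_def
  proof (rule conjI[OF W], rule exI[of _ r], rule conjI[OF \<open>r > 0\<close>], rule ballI)
    fix \<epsilon> assume \<epsilon>: "\<epsilon> \<in> {0<..r}"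
    \<comment> \<open>The zero has to lie in the product of balls on which the map is almost linear.\<close>
    define \<epsilon>' where "\<epsilon>' = min \<epsilon> \<rho>"
    have \<epsilon>': "\<epsilon>' > 0" "\<epsilon>' \<le> \<epsilon>" "\<epsilon>' \<le> \<rho>" "\<epsilon>' \<le> r" using \<epsilon> \<open>\<rho> > 0\<close> by (auto simp: \<epsilon>'_def)
    have "m / 2 * \<epsilon>' > 0" using m2 \<epsilon>' by simp
    from eventually_at_right_0_obtain[OF eventually_conj[OF eventually_at_right_0_le[OF \<open>r > 0\<close>]
          eventually_kkt_map_small[OF f cC2 this zero]]]
    obtain \<delta> where \<delta>: "\<delta> \<le> r" "\<delta> > 0"
      and small: "\<And>f' c'. C2_close \<delta> x (objf P) f' \<Longrightarrow> (\<forall>p\<in>S. C2_close \<delta> x (c p) (c' p)) \<Longrightarrow>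
        norm (kkt_map f' S c' (x, \<nu>)) \<le> m / 2 * \<epsilon>'"
      by auto
    show "\<exists>\<delta>>0. \<forall>Q. C2_mpsc I J k Q \<and> C2_norm (components I J k (mpsc_diff P Q)) (cball x r) \<le> \<delta> \<longrightarrow>
        (\<exists>y\<in>cball x \<epsilon>. W_stationary I J k Q y \<and> (\<forall>z\<in>cball x r. W_stationary I J k Q z \<longrightarrow> z = y))"
    proof (intro exI[of _ \<delta>] conjI \<delta>(2) allI impI, elim conjE)
      fix Q :: "('n, 'i, 'j) mpsc"
      assume Q: "C2_mpsc I J k Q" and "C2_norm (components I J k (mpsc_diff P Q)) (cball x r) \<le> \<delta>"
      then have le: "C2_le (\<lambda>y. objf P y - objf Q y) (cball x r) \<delta>"
        "\<And>l. l \<in> labels I J k \<Longrightarrow> C2_le (\<lambda>y. constraint P l y - constraint Q l y) (cball x r) \<delta>"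
        using C2_norm_mpsc_diff_le_iff[OF fin P Q] \<open>r > 0\<close> by (auto simp: less_imp_le)
      have close: "C2_close d x (objf P) (objf Q)" "\<forall>p\<in>S. C2_close d x (c p) (constraint Q (lab p))"
        "\<And>l. l \<in> labels I J k \<Longrightarrow> C2_close d x (constraint P l) (constraint Q l)" if "\<delta> \<le> d" "d \<le> r" for d
        using Q le labA that by (auto simp: C2_mpsc_iff c_def intro!: C2_closeI)
      note close_r = close[OF \<delta>(1) order_refl]
      let ?K = "kkt_map (objf Q) S (\<lambda>p. constraint Q (lab p))"
      have sgn: "sgn (constraint Q l y) = sgn (constraint P l x)"
        if "l \<in> labels I J k" "constraint P l x \<noteq> 0" "y \<in> cball x r" for l y
        using sign[OF that(1,2) close_r(3)[OF that(1)] that(3)] .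
      have inact: "\<forall>l\<in>labels I J k - ?A. constraint Q l y \<noteq> 0" if "y \<in> cball x r" for y
      proof
        fix l assume "l \<in> labels I J k - ?A"
        then have "l \<in> labels I J k" "constraint P l x \<noteq> 0" by (auto simp: active_eq[OF feas])
        from sgn[OF this that] this(2) show "constraint Q l y \<noteq> 0" by (metis sgn_0_0)
      qed
      have pos: "\<forall>j\<in>J. ineqf Q j y > 0" if "y \<in> cball x r" for y
      proof
        fix j assume j: "j \<in> J"
        then have "ineqf P j x > 0" using feas J0 by (force simp: feasible_set_def J0_def)
        then show "ineqf Q j y > 0"
          using sgn[of "Ineq j" y] that j by (simp add: sgn_if split: if_splits)
      qed
      have sub: "cball (x, \<nu>) \<epsilon>' \<subseteq> cball x r \<times> cball \<nu> \<rho>"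
      proof
        fix z assume "z \<in> cball (x, \<nu>) \<epsilon>'"
        then show "z \<in> cball x r \<times> cball \<nu> \<rho>"
          using dist_fst_le[of "(x, \<nu>)" z] dist_snd_le[of "(x, \<nu>)" z] \<epsilon>' by (auto simp: mem_Times_iff)
      qed
      have "\<exists>z\<in>cball (x, \<nu>) \<epsilon>'. ?K z = 0"
      proof (rule almost_linear_zero_exists[OF linT m])
        show "norm (?K z - ?K w - T (z - w)) \<le> m / 2 * norm (z - w)"
          if "z \<in> cball (x, \<nu>) \<epsilon>'" "w \<in> cball (x, \<nu>) \<epsilon>'" for z w
          using that sub by (intro almost[OF close_r(1,2)]) blast+
      qed (use small[OF close(1,2)[OF order_refl \<delta>(1)]] \<epsilon>' in auto)
      then obtain y u where yu: "(y, u) \<in> cball (x, \<nu>) \<epsilon>'" "?K (y, u) = 0" by auto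
      have y: "y \<in> cball x \<epsilon>" "y \<in> cball x r" "u \<in> cball \<nu> \<rho>"
        using yu(1) dist_fst_le[of "(x, \<nu>)" "(y, u)"] sub \<epsilon>' by auto
      have "W_stationary I J k Q y"
        by (rule kkt_zero_imp_W_stationary[OF fin feas lab pos[OF y(2)] inact[OF y(2)] yu(2)])
      moreover have "z = y" if z: "z \<in> cball x r" and Wz: "W_stationary I J k Q z" for z
      proof -
        have big: "\<eta> < \<bar>\<nu> $ p\<bar>" if "p \<in> S" "l \<in> \<beta>_set k P x" "lab p = Sw1 l \<or> lab p = Sw2 l" for p l
          using that ND3 by (intro \<eta>\<nu>) (auto simp: \<nu>_def \<Lambda>_def)
        obtain v where v: "?K (z, v) = 0" "norm (v - \<nu>) \<le> \<eta>"
          using W_stationary_imp_kkt_zero[OF fin feas J0 lab inact[OF z] Wz mclose[OF close_r(1,2) z] big] .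
        have "v \<in> cball \<nu> \<rho>" using v(2) \<open>\<eta> \<le> \<rho>\<close> by (simp add: dist_norm norm_minus_commute)
        then have "(z, v) \<in> cball x r \<times> cball \<nu> \<rho>" "(y, u) \<in> cball x r \<times> cball \<nu> \<rho>"
          using z y by auto
        from almost_linear_unique_zero[OF linT m almost[OF close_r(1,2)] this v(1) yu(2)]
        have "(z, v) = (y, u)" .
        then show ?thesis by simp
      qed
      ultimately show "\<exists>y\<in>cball x \<epsilon>. W_stationary I J k Q y \<and>
          (\<forall>z\<in>cball x r. W_stationary I J k Q z \<longrightarrow> z = y)"
        using y(1) by blast
    qed
  qed
qed

section \<open>Degenerate points are not strongly stable\<close>

lemma tendsto_difference_quotient:
  fixes g :: "'a::real_normed_vector \<Rightarrow> 'b::real_normed_vector"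
  assumes "(g has_derivative D) (at x)"
  shows "((\<lambda>s. (1 / s) *\<^sub>R (g (x + s *\<^sub>R \<xi>) - g x)) \<longlongrightarrow> D \<xi>) (at_right 0)"
proof -
  have lin: "((\<lambda>s. x + s *\<^sub>R \<xi>) has_derivative (\<lambda>s. s *\<^sub>R \<xi>)) (at (0::real))"
    by (auto intro!: derivative_eq_intros)
  have "(g has_derivative D) (at (x + 0 *\<^sub>R \<xi>))" using assms by simp
  from has_derivative_compose[OF lin this]
  have D: "((\<lambda>s. g (x + s *\<^sub>R \<xi>)) has_derivative (\<lambda>s. s *\<^sub>R D \<xi>)) (at 0)"
    using linear_cmul[OF has_derivative_linear[OF assms]] by simp
  have "((\<lambda>s. norm (g (x + s *\<^sub>R \<xi>) - g x - s *\<^sub>R D \<xi>) / norm s) \<longlongrightarrow> 0) (at 0)"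
    using D by (simp add: has_derivative_at)
  then have "((\<lambda>s. norm ((1 / s) *\<^sub>R (g (x + s *\<^sub>R \<xi>) - g x) - D \<xi>)) \<longlongrightarrow> 0) (at 0)"
  proof (rule Lim_transform_eventually)
    show "\<forall>\<^sub>F s in at 0. norm (g (x + s *\<^sub>R \<xi>) - g x - s *\<^sub>R D \<xi>) / norm s =
        norm ((1 / s) *\<^sub>R (g (x + s *\<^sub>R \<xi>) - g x) - D \<xi>)"
      unfolding eventually_at_filter
    proof (intro always_eventually allI impI)
      fix s :: real assume "s \<noteq> 0"
      then have "(1 / s) *\<^sub>R (g (x + s *\<^sub>R \<xi>) - g x) - D \<xi> =
          (1 / s) *\<^sub>R (g (x + s *\<^sub>R \<xi>) - g x - s *\<^sub>R D \<xi>)"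
        by (simp add: scaleR_diff_right)
      then show "norm (g (x + s *\<^sub>R \<xi>) - g x - s *\<^sub>R D \<xi>) / norm s =
          norm ((1 / s) *\<^sub>R (g (x + s *\<^sub>R \<xi>) - g x) - D \<xi>)"
        by simp
    qed
  qed
  from LIM_zero_cancel[OF tendsto_norm_zero_cancel[OF this]] show ?thesis
    by (rule tendsto_mono[OF at_le, rotated]) simp
qed

lemma tendsto_along_ray:
  fixes \<xi> :: "'a::real_normed_vector"
  assumes "isCont g x"
  shows "((\<lambda>s. g (x + s *\<^sub>R \<xi>)) \<longlongrightarrow> g x) (at_right (0::real))"
proof (rule isCont_tendsto_compose[OF assms])
  have "((\<lambda>s::real. x + s *\<^sub>R \<xi>) \<longlongrightarrow> x + 0 *\<^sub>R \<xi>) (at_right 0)" by (intro tendsto_intros)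
  then show "((\<lambda>s::real. x + s *\<^sub>R \<xi>) \<longlongrightarrow> x) (at_right 0)" by simp
qed

definition mpsc_of ::
    "(real ^ 'n::finite \<Rightarrow> real) \<Rightarrow> (('i, 'j) label \<Rightarrow> real ^ 'n \<Rightarrow> real) \<Rightarrow> ('n, 'i, 'j) mpsc" where
  "mpsc_of f con = \<lparr>objf = f, eqf = (\<lambda>i. con (Eq i)), ineqf = (\<lambda>j. con (Ineq j)),
     F1 = (\<lambda>m. con (Sw1 m)), F2 = (\<lambda>m. con (Sw2 m))\<rparr>"

lemma objf_mpsc_of [simp]: "objf (mpsc_of f con) = f"
  and constraint_mpsc_of [simp]: "constraint (mpsc_of f con) c = con c"
  by (simp_all add: mpsc_of_def) (cases c; simp)

text \<open>For a unit vector \<open>\<xi>\<close> this function has a zero gradient at \<open>x\<close> and the gradient \<open>s u\<close> at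
  \<open>x + s \<xi>\<close>: up to the factor \<open>1/2\<close> it is the quadratic form of the symmetric matrix
  \<open>u \<xi>\<^sup>T + \<xi> u\<^sup>T - (u \<cdot> \<xi>) \<xi> \<xi>\<^sup>T\<close>, which maps \<open>\<xi>\<close> to \<open>u\<close>. The factor \<open>(z - x) \<cdot> u\<close> is spelled out in
  coordinates so that the function is a combination of fixed functions with coefficients that tend
  to zero with \<open>u\<close>, which makes its \<open>C\<^sup>2\<close> norm small.\<close>

definition interp_quad :: "real ^ 'n::finite \<Rightarrow> real ^ 'n \<Rightarrow> real ^ 'n \<Rightarrow> real ^ 'n \<Rightarrow> real" where
  "interp_quad x \<xi> u z =
     (\<Sum>i\<in>UNIV. u $ i * (inner (z - x) \<xi> * inner (z - x) (axis i 1))) +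
     - (inner u \<xi> / 2) * (inner (z - x) \<xi> * inner (z - x) \<xi>)"

lemma interp_quad_C2: "C2 (interp_quad x \<xi> u)"
  unfolding interp_quad_def[abs_def] by (intro C2_add C2_sum C2_cmult C2_mult C2_inner)

lemma sum_axis: "(\<Sum>i\<in>UNIV. u $ i *\<^sub>R axis i 1) = (u :: real ^ 'n::finite)"
  using basis_expansion[of u] by (simp add: scalar_mult_eq_scaleR)

lemma gradient_interp_quad:
  fixes u :: "real ^ 'n::finite"
  shows "gradient (interp_quad x \<xi> u) z =
    inner (z - x) \<xi> *\<^sub>R u + inner (z - x) u *\<^sub>R \<xi> - (inner u \<xi> * inner (z - x) \<xi>) *\<^sub>R \<xi>"
proof -
  note C = C2_imp_C1[OF C2_inner]
  have summand: "gradient (\<lambda>z. u $ i * (inner (z - x) \<xi> * inner (z - x) (axis i 1))) z =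
      inner (z - x) \<xi> *\<^sub>R (u $ i *\<^sub>R axis i 1) + (u $ i * (z - x) $ i) *\<^sub>R \<xi>" for i
    unfolding gradient_cmult[OF C1_mult[OF C C]] gradient_mult[OF C C] gradient_inner
    by (simp add: inner_axis algebra_simps)
  have "gradient (interp_quad x \<xi> u) z =
      (\<Sum>i\<in>UNIV. gradient (\<lambda>z. u $ i * (inner (z - x) \<xi> * inner (z - x) (axis i 1))) z) +
      gradient (\<lambda>z. - (inner u \<xi> / 2) * (inner (z - x) \<xi> * inner (z - x) \<xi>)) z"
  proof -
    have 1: "C2 (\<lambda>z. u $ i * (inner (z - x) \<xi> * inner (z - x) (axis i 1)))" for i
      by (intro C2_cmult C2_mult C2_inner)
    have 2: "C2 (\<lambda>z. - (inner u \<xi> / 2) * (inner (z - x) \<xi> * inner (z - x) \<xi>))"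
      by (intro C2_cmult C2_mult C2_inner)
    show ?thesis
      unfolding interp_quad_def[abs_def] gradient_add[OF C2_imp_C1[OF C2_sum[OF 1]] C2_imp_C1[OF 2]]
        gradient_sum[OF 1] ..
  qed
  also have "gradient (\<lambda>z. - (inner u \<xi> / 2) * (inner (z - x) \<xi> * inner (z - x) \<xi>)) z =
      - ((inner u \<xi> * inner (z - x) \<xi>) *\<^sub>R \<xi>)"
    by (simp only: gradient_cmult[OF C1_mult[OF C C]] gradient_mult[OF C C] gradient_inner)
      (simp flip: scaleR_add_left)
  also have "(\<Sum>i\<in>UNIV. gradient (\<lambda>z. u $ i * (inner (z - x) \<xi> * inner (z - x) (axis i 1))) z) =
      inner (z - x) \<xi> *\<^sub>R u + inner (z - x) u *\<^sub>R \<xi>"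
    unfolding summand sum.distrib scaleR_sum_right[symmetric] sum_axis scaleR_sum_left[symmetric]
    by (simp add: inner_vec_def mult.commute)
  finally show ?thesis by simp
qed

lemma interp_quad_C2_le:
  fixes x \<xi> :: "real ^ 'n::finite"
  assumes "compact B"
  obtains M :: "'n \<Rightarrow> real" and N where
    "\<And>u. C2_le (interp_quad x \<xi> u) B ((\<Sum>i\<in>UNIV. \<bar>u $ i\<bar> * M i) + \<bar>inner u \<xi> / 2\<bar> * N)"
proof -
  have C2: "C2 (\<lambda>z. inner (z - x) \<xi> * inner (z - x) v)" for v
    by (intro C2_mult C2_inner)
  have "\<forall>i. \<exists>M. C2_le (\<lambda>z. inner (z - x) \<xi> * inner (z - x) (axis i 1)) B M"
    using C2_le_exists[OF C2 assms] by blast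
  from choice[OF this]
  obtain M where M: "\<And>i. C2_le (\<lambda>z. inner (z - x) \<xi> * inner (z - x) (axis i 1)) B (M i)"
    by blast
  obtain N where N: "C2_le (\<lambda>z. inner (z - x) \<xi> * inner (z - x) \<xi>) B N"
    using C2_le_exists[OF C2 assms] by blast
  have "C2_le (interp_quad x \<xi> u) B ((\<Sum>i\<in>UNIV. \<bar>u $ i\<bar> * M i) + \<bar>- (inner u \<xi> / 2)\<bar> * N)" for u
    unfolding interp_quad_def[abs_def]
    by (intro C2_le_add C2_le_sum C2_le_cmult C2_sum C2_cmult C2 conjI M N)
  then have "C2_le (interp_quad x \<xi> u) B ((\<Sum>i\<in>UNIV. \<bar>u $ i\<bar> * M i) + \<bar>inner u \<xi> / 2\<bar> * N)" for u
    unfolding abs_minus_cancel .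
  then show thesis by (rule that)
qed

text \<open>To first order in \<open>s\<close>, the point \<open>x + s \<xi>\<close> satisfies the constraints in \<open>B\<close>, as \<open>\<xi>\<close> is tangential
  to them, and it is stationary up to the terms \<open>s \<nu> c\<close> with \<open>c\<close> outside \<open>B\<close>. The perturbed program
  removes the remaining errors, all of order \<open>o(s)\<close>.
  Each constraint \<open>c\<close> in \<open>B\<close> loses the linear function \<open>\<kappa> c s * t\<close>, which vanishes at \<open>x\<close> and equals
  the value of the constraint at \<open>x + s \<xi>\<close>. The objective changes by the same linear functions weighted
  with \<open>\<Lambda>\<close>, so that \<open>x\<close> remains stationary, by \<open>s \<nu> c\<close> times each constraint \<open>c\<close> in \<open>A - B\<close>, which
  only shifts the multipliers at \<open>x\<close>, and by a quadratic function that has no effect on the gradient at \<open>x\<close>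
  and corrects it at \<open>x + s \<xi>\<close> by the missing amount \<open>s u\<close>.
  All coefficients tend to zero with \<open>s\<close>: errors of order \<open>o(s)\<close> at two points at distance \<open>s\<close> cost
  only \<open>o(1)\<close> in the \<open>C\<^sup>2\<close> norm. The multipliers are \<open>\<Lambda>\<close>, up to the shift, at \<open>x\<close> and \<open>\<Lambda> + s \<nu>\<close> on \<open>B\<close>
  at \<open>x + s \<xi>\<close>.\<close>

lemma two_W_stationary_points:
  fixes P :: "('n::finite, 'i, 'j) mpsc" and \<Lambda> \<nu> :: "('i, 'j) label \<Rightarrow> real"
  assumes fin: "finite I" "finite J" and P: "C2_mpsc I J k P"
    and feas: "x \<in> feasible_set I J k P" and J0: "J0 J P x = {}"
    and A: "A = active I J k P x" and "B \<subseteq> A"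
    and BI: "\<forall>i\<in>I. Eq i \<in> B" and Bk: "\<forall>m\<in>{1..k}. Sw1 m \<in> B \<or> Sw2 m \<in> B"
    and stat: "gradient (objf P) x = (\<Sum>c\<in>A. \<Lambda> c *\<^sub>R gradient (constraint P c) x)"
    and \<Lambda>B: "\<forall>c\<in>A - B. \<Lambda> c = 0"
    and \<xi>1: "norm \<xi> = 1" and tan: "\<forall>c\<in>B. inner (gradient (constraint P c) x) \<xi> = 0"
    and ker: "\<xi> v* (hessian (objf P) x - (\<Sum>c\<in>A. \<Lambda> c *\<^sub>R hessian (constraint P c) x)) =
      (\<Sum>c\<in>A. \<nu> c *\<^sub>R gradient (constraint P c) x)"
    and "r > 0" and "\<delta> > 0"
  shows "\<exists>Q y. C2_mpsc I J k Q \<and> C2_norm (components I J k (mpsc_diff P Q)) (cball x r) \<le> \<delta> \<and>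
    y \<in> cball x r \<and> y \<noteq> x \<and> W_stationary I J k Q x \<and> W_stationary I J k Q y"
proof -
  have fA: "finite A" unfolding A
    using finite_subset[OF active_subset_labels finite_labels[OF fin]] .
  have fB: "finite B" using finite_subset[OF \<open>B \<subseteq> A\<close> fA] .
  have AL: "c \<in> labels I J k" "constraint P c x = 0" if "c \<in> A" for c
    using that by (auto simp: A active_eq[OF feas])
  have f: "C2 (objf P)" and con: "\<And>c. c \<in> labels I J k \<Longrightarrow> C2 (constraint P c)"
    using P by (auto simp: C2_mpsc_iff)
  have conA: "C2 (constraint P c)" if "c \<in> A" for c using con AL that by blast
  have gpos: "ineqf P j x > 0" if "j \<in> J" for j
    using feas J0 that by (force simp: feasible_set_def J0_def)
  have IneqA: "Ineq j \<notin> A" for j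
    using J0 by (auto simp: A active_def)
  define t where "t z = inner (z - x) \<xi>" for z
  have t: "C2 t" unfolding t_def[abs_def] by (rule C2_inner)
  have grad_t: "gradient t z = \<xi>" for z unfolding t_def[abs_def] by (rule gradient_inner)
  define L where "L z = objf P z - (\<Sum>c\<in>A. \<Lambda> c * constraint P c z)" for z
  have L: "C2 L" unfolding L_def[abs_def] by (intro C2_diff C2_sum C2_cmult conA f)
  have grad_L: "gradient L z = gradient (objf P) z - (\<Sum>c\<in>A. \<Lambda> c *\<^sub>R gradient (constraint P c) z)" for z
    unfolding L_def[abs_def] using conA
    by (subst gradient_diff) (auto intro!: C2_imp_C1 f C2_sum C2_cmult
        simp: gradient_sum[OF C2_cmult] gradient_cmult[OF C2_imp_C1])
  define y where "y s = x + s *\<^sub>R \<xi>" for s :: real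
  have ty: "t (y s) = s" for s
    using \<xi>1 by (simp add: t_def y_def dot_square_norm)
  \<comment> \<open>The slope that the constraint has to lose in order to vanish at \<open>y s\<close>.\<close>
  define \<kappa> where "\<kappa> c s = constraint P c (y s) / s" for c s
  \<comment> \<open>\<open>s u s\<close> is the gradient that the objective lacks at \<open>y s\<close> for the multipliers \<open>\<Lambda> + s \<nu>\<close>;
    the gradient of \<open>L\<close> at \<open>x\<close> is zero and turns the last term into a difference quotient.\<close>
  define u where "u s = (\<Sum>c\<in>A. \<nu> c *\<^sub>R gradient (constraint P c) (y s)) -
      (\<Sum>c\<in>B. (\<nu> c * \<kappa> c s) *\<^sub>R \<xi>) - (1 / s) *\<^sub>R (gradient L (y s) - gradient L x)" for s
  have lim_\<kappa>: "(\<kappa> c \<longlongrightarrow> 0) (at_right 0)" if c: "c \<in> B" for c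
  proof -
    have cA: "c \<in> A" using c \<open>B \<subseteq> A\<close> by blast
    have "((\<lambda>s. (1 / s) *\<^sub>R (constraint P c (x + s *\<^sub>R \<xi>) - constraint P c x)) \<longlongrightarrow>
        inner (gradient (constraint P c) x) \<xi>) (at_right 0)"
      by (rule tendsto_difference_quotient) (rule C1_has_derivative[OF C2_imp_C1[OF conA[OF cA]]])
    then show ?thesis
      using tan c AL(2)[OF cA] by (simp add: \<kappa>_def[abs_def] y_def)
  qed
  have lim_u: "(u \<longlongrightarrow> 0) (at_right 0)"
  proof -
    have "((\<lambda>s. (1 / s) *\<^sub>R (gradient L (y s) - gradient L x)) \<longlongrightarrow> \<xi> v* hessian L x) (at_right 0)"
      unfolding y_def by (rule tendsto_difference_quotient) (rule has_derivative_gradient_hessian[OF L])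
    moreover have "((\<lambda>s. gradient (constraint P c) (y s)) \<longlongrightarrow> gradient (constraint P c) x) (at_right 0)"
      if "c \<in> A" for c
      unfolding y_def
      by (rule tendsto_along_ray)
        (rule has_derivative_continuous[OF has_derivative_gradient_hessian[OF conA[OF that]]])
    ultimately have "(u \<longlongrightarrow> (\<Sum>c\<in>A. \<nu> c *\<^sub>R gradient (constraint P c) x) -
        (\<Sum>c\<in>B. (\<nu> c * 0) *\<^sub>R \<xi>) - \<xi> v* hessian L x) (at_right 0)"
      unfolding u_def by (intro tendsto_intros lim_\<kappa>) auto
    moreover have "hessian L x = hessian (objf P) x - (\<Sum>c\<in>A. \<Lambda> c *\<^sub>R hessian (constraint P c) x)"
      unfolding L_def[abs_def] by (rule hessian_lagrangian[OF f conA])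
    ultimately show ?thesis using ker by simp
  qed
  \<comment> \<open>The slope added to the objective keeps the Lagrangian with multipliers \<open>\<Lambda>\<close> unchanged.\<close>
  define a where "a s = (\<Sum>c\<in>B. \<Lambda> c * \<kappa> c s)" for s
  define con' where "con' s c = (if c \<in> B then (\<lambda>z. constraint P c z - \<kappa> c s * t z) else constraint P c)" for s c
  define pert where "pert s z = a s * t z + ((\<Sum>c\<in>A - B. (s * \<nu> c) * constraint P c z) +
      (- 1) * interp_quad x \<xi> (u s) z)" for s z
  define Q where "Q s = mpsc_of (\<lambda>z. objf P z - pert s z) (con' s)" for s
  have pert: "C2 (pert s)" for s
    unfolding pert_def[abs_def] by (intro C2_add C2_cmult C2_sum conA t interp_quad_C2) auto
  have con': "C2 (con' s c)" if "c \<in> labels I J k" for s c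
    using con[OF that] t by (auto simp: con'_def intro!: C2_diff C2_cmult)
  have QC2: "C2_mpsc I J k (Q s)" for s
    unfolding C2_mpsc_iff Q_def by (auto intro!: C2_diff f pert con')
  obtain Mt where Mt: "C2_le t (cball x r) Mt" using C2_le_exists[OF t compact_cball] by blast
  have "\<forall>c\<in>A. \<exists>M. C2_le (constraint P c) (cball x r) M"
    using C2_le_exists[OF conA compact_cball] by blast
  then obtain Mc where Mc: "\<And>c. c \<in> A \<Longrightarrow> C2_le (constraint P c) (cball x r) (Mc c)" by metis
  obtain M N where MN: "\<And>u. C2_le (interp_quad x \<xi> u) (cball x r)
      ((\<Sum>i\<in>UNIV. \<bar>u $ i\<bar> * M i) + \<bar>inner u \<xi> / 2\<bar> * N)"
    using interp_quad_C2_le[OF compact_cball] by metis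
  define size where "size s = \<bar>a s\<bar> * Mt + ((\<Sum>c\<in>A - B. \<bar>s * \<nu> c\<bar> * Mc c) +
      \<bar>- 1\<bar> * ((\<Sum>i\<in>UNIV. \<bar>u s $ i\<bar> * M i) + \<bar>inner (u s) \<xi> / 2\<bar> * N))" for s
  have pert_le: "C2_le (pert s) (cball x r) (size s)" for s
    unfolding pert_def[abs_def] size_def
    by (intro C2_le_add C2_le_sum C2_le_cmult C2_sum C2_cmult conjI conA Mc t Mt MN interp_quad_C2 C2_add) auto
  have lim_a: "(a \<longlongrightarrow> 0) (at_right 0)"
    unfolding a_def by (rule tendsto_eq_intros refl lim_\<kappa> | assumption)+ simp
  have "(size \<longlongrightarrow> \<bar>0\<bar> * Mt + ((\<Sum>c\<in>A - B. \<bar>0 * \<nu> c\<bar> * Mc c) +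
      \<bar>- 1\<bar> * ((\<Sum>i\<in>UNIV. \<bar>(0 :: real ^ 'n) $ i\<bar> * M i) + \<bar>inner 0 \<xi> / 2\<bar> * N))) (at_right 0)"
    unfolding size_def by (intro tendsto_intros lim_a lim_u) auto
  then have lim_size: "(size \<longlongrightarrow> 0) (at_right 0)" by simp
  have ev_size: "\<forall>\<^sub>F s in at_right 0. size s < \<delta>"
    using order_tendstoD(2)[OF lim_size \<open>\<delta> > 0\<close>] .
  have ev_con: "\<forall>\<^sub>F s in at_right 0. \<forall>c\<in>B. \<bar>\<kappa> c s\<bar> * Mt < \<delta>"
  proof (intro eventually_ball_finite fB ballI)
    fix c assume c: "c \<in> B"
    have "((\<lambda>s. \<bar>\<kappa> c s\<bar> * Mt) \<longlongrightarrow> \<bar>0\<bar> * Mt) (at_right 0)" by (intro tendsto_intros lim_\<kappa> c)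
    then show "\<forall>\<^sub>F s in at_right 0. \<bar>\<kappa> c s\<bar> * Mt < \<delta>" using \<open>\<delta> > 0\<close> by (simp add: order_tendstoD(2))
  qed
  have ev_g: "\<forall>\<^sub>F s in at_right 0. \<forall>j\<in>J. ineqf P j (y s) > 0"
  proof (intro eventually_ball_finite fin ballI)
    fix j assume j: "j \<in> J"
    have "isCont (ineqf P j) x"
      using C1_continuous[OF C2_imp_C1[OF con[of "Ineq j"]], of UNIV] j
      by (simp add: continuous_on_eq_continuous_at)
    from order_tendstoD(1)[OF tendsto_along_ray[OF this] gpos[OF j]]
    show "\<forall>\<^sub>F s in at_right 0. ineqf P j (y s) > 0" by (simp add: y_def)
  qed
  obtain s where "s > 0" "s \<le> r" and small: "size s < \<delta>" "\<forall>c\<in>B. \<bar>\<kappa> c s\<bar> * Mt < \<delta>"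
    and gpos': "\<forall>j\<in>J. ineqf P j (y s) > 0"
    using eventually_at_right_0_obtain[OF eventually_conj[OF eventually_conj[OF ev_size ev_con]
          eventually_conj[OF ev_g eventually_at_right_0_le[OF \<open>r > 0\<close>]]]] by blast
  have norm: "C2_norm (components I J k (mpsc_diff P (Q s))) (cball x r) \<le> \<delta>"
  proof (subst C2_norm_mpsc_diff_le_iff[OF fin P QC2], use \<open>r > 0\<close> in simp, intro conjI ballI)
    show "C2_le (\<lambda>z. objf P z - objf (Q s) z) (cball x r) \<delta>"
      using C2_le_mono[OF pert_le[of s], of \<delta>] small by (simp add: Q_def)
    fix c assume c: "c \<in> labels I J k"
    show "C2_le (\<lambda>z. constraint P c z - constraint (Q s) c z) (cball x r) \<delta>"
    proof (cases "c \<in> B")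
      case True
      have "C2_le (\<lambda>z. \<kappa> c s * t z) (cball x r) \<delta>"
        using C2_le_mono[OF C2_le_cmult[OF t Mt], of "\<kappa> c s" \<delta>] small True by auto
      then show ?thesis using True by (simp add: Q_def con'_def)
    next
      case False
      then show ?thesis using \<open>\<delta> > 0\<close>
        by (simp add: Q_def con'_def C2_le_def partial_deriv_const)
    qed
  qed
  have grad_con: "gradient (con' s c) z = gradient (constraint P c) z - (if c \<in> B then \<kappa> c s *\<^sub>R \<xi> else 0)"
    if "c \<in> A" for c z
    using conA[OF that] t
    by (simp add: con'_def gradient_diff C2_imp_C1 C1_mult[OF C1_const] gradient_cmult grad_t)
  have grad_pert: "gradient (pert s) z = a s *\<^sub>R \<xi> + ((\<Sum>c\<in>A - B. (s * \<nu> c) *\<^sub>R gradient (constraint P c) z) -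
      gradient (interp_quad x \<xi> (u s)) z)" for z
  proof -
    have 1: "C2 (\<lambda>z. a s * t z)" by (intro C2_cmult t)
    have 2: "C2 (\<lambda>z. (s * \<nu> c) * constraint P c z)" if "c \<in> A - B" for c
      using conA that by (intro C2_cmult) auto
    have 3: "C2 (\<lambda>z. (- 1) * interp_quad x \<xi> (u s) z)" by (intro C2_cmult interp_quad_C2)
    have 4: "C2 (\<lambda>z. \<Sum>c\<in>A - B. (s * \<nu> c) * constraint P c z)" using 2 by (rule C2_sum)
    have "gradient (pert s) z = gradient (\<lambda>z. a s * t z) z +
        ((\<Sum>c\<in>A - B. gradient (\<lambda>z. (s * \<nu> c) * constraint P c z) z) + gradient (\<lambda>z. (- 1) * interp_quad x \<xi> (u s) z) z)"
      unfolding pert_def[abs_def] gradient_add[OF C2_imp_C1[OF 1] C2_imp_C1[OF C2_add[OF 4 3]]]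
        gradient_add[OF C2_imp_C1[OF 4] C2_imp_C1[OF 3]] by (subst gradient_sum) (auto intro: 2)
    moreover have "gradient (\<lambda>z. (s * \<nu> c) * constraint P c z) z = (s * \<nu> c) *\<^sub>R gradient (constraint P c) z"
      if "c \<in> A - B" for c
      using conA that by (intro gradient_cmult C2_imp_C1) auto
    ultimately show ?thesis
      unfolding gradient_cmult[OF C2_imp_C1[OF t]] gradient_cmult[OF C2_imp_C1[OF interp_quad_C2]] grad_t
      by simp
  qed
  have grad_obj: "gradient (objf (Q s)) z = gradient (objf P) z - gradient (pert s) z" for z
    by (simp add: Q_def gradient_diff[OF C2_imp_C1[OF f] C2_imp_C1[OF pert]])
  have Qc: "constraint (Q s) c = con' s c" for c by (simp add: Q_def)
  have sumA: "sum h A = sum h B + sum h (A - B)" for h :: "('i, 'j) label \<Rightarrow> real ^ 'n"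
    using sum.subset_diff[OF \<open>B \<subseteq> A\<close> fA, of h] by (simp add: add.commute)
  have Q_Ineq: "ineqf (Q s) j = ineqf P j" for j
    using Qc[of "Ineq j"] IneqA \<open>B \<subseteq> A\<close> by (auto simp: con'_def)
  have same: "constraint (Q s) c x = constraint P c x" for c
    unfolding Qc by (simp add: con'_def t_def)
  have "W_stationary I J k (Q s) x"
  proof -
    have feasQ: "x \<in> feasible_set I J k (Q s)"
      using feas unfolding feasible_iff same .
    have act: "active I J k (Q s) x = A"
      unfolding A active_eq[OF feasQ] active_eq[OF feas] same ..
    have "J0 J (Q s) x = {}" using J0 by (simp add: J0_def Q_Ineq)
    moreover have "gradient (objf (Q s)) x =
        (\<Sum>c\<in>A. (\<Lambda> c - (if c \<in> B then 0 else s * \<nu> c)) *\<^sub>R gradient (constraint (Q s) c) x)"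
    proof -
      have "(\<Sum>c\<in>A. (\<Lambda> c - (if c \<in> B then 0 else s * \<nu> c)) *\<^sub>R gradient (constraint (Q s) c) x) =
          (\<Sum>c\<in>A. \<Lambda> c *\<^sub>R gradient (constraint P c) x) - (\<Sum>c\<in>B. (\<Lambda> c * \<kappa> c s) *\<^sub>R \<xi>) -
          (\<Sum>c\<in>A - B. (s * \<nu> c) *\<^sub>R gradient (constraint P c) x)"
        using \<open>B \<subseteq> A\<close> unfolding sumA Qc
        by (simp add: grad_con subset_iff sum_subtractf algebra_simps)
      also have "\<dots> = gradient (objf (Q s)) x"
        unfolding grad_obj grad_pert gradient_interp_quad stat
        by (simp add: a_def scaleR_sum_left)
      finally show ?thesis by simp
    qed
    ultimately show ?thesis
      unfolding W_stationary_iff[OF fin] act using feasQ by auto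
  qed
  moreover have "W_stationary I J k (Q s) (y s)"
  proof -
    have zero: "constraint (Q s) c (y s) = 0" if "c \<in> B" for c
      using that \<open>s > 0\<close> by (simp add: Qc con'_def ty \<kappa>_def)
    have feasQ: "y s \<in> feasible_set I J k (Q s)"
      unfolding feasible_iff
    proof (intro conjI ballI)
      show "constraint (Q s) (Eq i) (y s) = 0" if "i \<in> I" for i
        using BI that by (intro zero) blast
      show "constraint (Q s) (Ineq j) (y s) \<ge> 0" if "j \<in> J" for j
        using gpos' that by (simp add: Q_Ineq less_imp_le)
      show "constraint (Q s) (Sw1 m) (y s) = 0 \<or> constraint (Q s) (Sw2 m) (y s) = 0" if "m \<in> {1..k}" for m
        using Bk that zero by blast
    qed
    have BA: "B \<subseteq> active I J k (Q s) (y s)"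
      using zero AL \<open>B \<subseteq> A\<close> by (auto simp: active_eq[OF feasQ])
    have fact: "finite (active I J k (Q s) (y s))"
      using finite_subset[OF active_subset_labels finite_labels[OF fin]] .
    have "J0 J (Q s) (y s) = {}" using gpos' by (auto simp: J0_def Q_Ineq)
    moreover have "gradient (objf (Q s)) (y s) = (\<Sum>c\<in>B. (\<Lambda> c + s * \<nu> c) *\<^sub>R gradient (constraint (Q s) c) (y s))"
    proof -
      have quad: "gradient (interp_quad x \<xi> (u s)) (y s) = s *\<^sub>R u s"
        unfolding gradient_interp_quad using \<xi>1
        by (simp add: y_def dot_square_norm inner_commute[of \<xi> "u s"])
      have su: "s *\<^sub>R u s = s *\<^sub>R (\<Sum>c\<in>A. \<nu> c *\<^sub>R gradient (constraint P c) (y s)) -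
          s *\<^sub>R (\<Sum>c\<in>B. (\<nu> c * \<kappa> c s) *\<^sub>R \<xi>) - gradient L (y s)"
        using \<open>s > 0\<close> stat by (simp add: u_def scaleR_diff_right grad_L)
      have \<Lambda>sum: "(\<Sum>c\<in>A. \<Lambda> c *\<^sub>R gradient (constraint P c) (y s)) = (\<Sum>c\<in>B. \<Lambda> c *\<^sub>R gradient (constraint P c) (y s))"
        unfolding sumA using \<Lambda>B by simp
      have "(\<Sum>c\<in>B. (\<Lambda> c + s * \<nu> c) *\<^sub>R gradient (constraint (Q s) c) (y s)) =
          (\<Sum>c\<in>B. (\<Lambda> c + s * \<nu> c) *\<^sub>R (gradient (constraint P c) (y s) - \<kappa> c s *\<^sub>R \<xi>))"
        using \<open>B \<subseteq> A\<close> by (intro sum.cong) (auto simp: Qc grad_con subset_iff)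
      also have "\<dots> = (\<Sum>c\<in>B. \<Lambda> c *\<^sub>R gradient (constraint P c) (y s)) +
          (\<Sum>c\<in>B. (s * \<nu> c) *\<^sub>R gradient (constraint P c) (y s)) -
          (\<Sum>c\<in>B. (\<Lambda> c * \<kappa> c s) *\<^sub>R \<xi>) - s *\<^sub>R (\<Sum>c\<in>B. (\<nu> c * \<kappa> c s) *\<^sub>R \<xi>)"
        by (simp add: scaleR_sum_right sum.distrib sum_subtractf algebra_simps)
      also have "\<dots> = gradient (objf (Q s)) (y s)"
        unfolding grad_obj grad_pert quad su grad_L \<Lambda>sum
        unfolding sumA by (simp add: a_def scaleR_sum_left scaleR_sum_right algebra_simps)
      finally show ?thesis by simp
    qed
    moreover have "(\<Sum>c\<in>B. (\<Lambda> c + s * \<nu> c) *\<^sub>R gradient (constraint (Q s) c) (y s)) =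
        (\<Sum>c\<in>active I J k (Q s) (y s). (if c \<in> B then \<Lambda> c + s * \<nu> c else 0) *\<^sub>R gradient (constraint (Q s) c) (y s))"
      using BA fact by (intro sum.mono_neutral_cong_left) auto
    ultimately show ?thesis
      unfolding W_stationary_iff[OF fin] using feasQ by auto
  qed
  moreover have "y s \<in> cball x r" "y s \<noteq> x"
    using \<open>s > 0\<close> \<open>s \<le> r\<close> \<xi>1 by (auto simp: y_def dist_norm)
  ultimately show ?thesis using QC2 norm by blast
qed

lemma not_strongly_stableI:
  fixes P :: "('n::finite, 'i, 'j) mpsc" and \<Lambda> \<nu> :: "('i, 'j) label \<Rightarrow> real"
  assumes fin: "finite I" "finite J" and P: "C2_mpsc I J k P"
    and feas: "x \<in> feasible_set I J k P" and J0: "J0 J P x = {}"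
    and A: "A = active I J k P x" and "B \<subseteq> A"
    and BI: "\<forall>i\<in>I. Eq i \<in> B" and Bk: "\<forall>m\<in>{1..k}. Sw1 m \<in> B \<or> Sw2 m \<in> B"
    and stat: "gradient (objf P) x = (\<Sum>c\<in>A. \<Lambda> c *\<^sub>R gradient (constraint P c) x)"
    and \<Lambda>B: "\<forall>c\<in>A - B. \<Lambda> c = 0"
    and "\<xi> \<noteq> 0" and tan: "\<forall>c\<in>B. inner (gradient (constraint P c) x) \<xi> = 0"
    and ker: "\<xi> v* (hessian (objf P) x - (\<Sum>c\<in>A. \<Lambda> c *\<^sub>R hessian (constraint P c) x)) =
      (\<Sum>c\<in>A. \<nu> c *\<^sub>R gradient (constraint P c) x)"
  shows "\<not> strongly_stable I J k P x"
proof
  assume "strongly_stable I J k P x"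
  then obtain r where "r > 0" and r: "\<forall>\<epsilon>\<in>{0<..r}. \<exists>\<delta>>0. \<forall>Q. C2_mpsc I J k Q \<and>
        C2_norm (components I J k (mpsc_diff P Q)) (cball x r) \<le> \<delta> \<longrightarrow>
        (\<exists>y\<in>cball x \<epsilon>. W_stationary I J k Q y \<and> (\<forall>z\<in>cball x r. W_stationary I J k Q z \<longrightarrow> z = y))"
    unfolding strongly_stable_def by blast
  have "r \<in> {0<..r}" using \<open>r > 0\<close> by simp
  from bspec[OF r this] obtain \<delta> where "\<delta> > 0" and \<delta>: "\<forall>Q. C2_mpsc I J k Q \<and>
        C2_norm (components I J k (mpsc_diff P Q)) (cball x r) \<le> \<delta> \<longrightarrow>
        (\<exists>y\<in>cball x r. W_stationary I J k Q y \<and> (\<forall>z\<in>cball x r. W_stationary I J k Q z \<longrightarrow> z = y))"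
    by (elim exE conjE)
  define \<zeta> where "\<zeta> = (1 / norm \<xi>) *\<^sub>R \<xi>"
  have "\<zeta> v* H = (1 / norm \<xi>) *\<^sub>R (\<xi> v* H)" for H :: "real ^ 'n ^ 'n"
    by (simp add: \<zeta>_def Finite_Cartesian_Product.vec_eq_iff vector_matrix_mult_def sum_distrib_left sum_divide_distrib)
  then have ker': "\<zeta> v* (hessian (objf P) x - (\<Sum>c\<in>A. \<Lambda> c *\<^sub>R hessian (constraint P c) x)) =
      (\<Sum>c\<in>A. (1 / norm \<xi> * \<nu> c) *\<^sub>R gradient (constraint P c) x)"
    by (simp only: ker) (simp add: scaleR_sum_right)
  have "norm \<zeta> = 1" "\<forall>c\<in>B. inner (gradient (constraint P c) x) \<zeta> = 0"
    using \<open>\<xi> \<noteq> 0\<close> tan by (simp_all add: \<zeta>_def)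
  from two_W_stationary_points[OF fin P feas J0 A \<open>B \<subseteq> A\<close> BI Bk stat \<Lambda>B this ker' \<open>r > 0\<close> \<open>\<delta> > 0\<close>]
  obtain Q y where "C2_mpsc I J k Q" "C2_norm (components I J k (mpsc_diff P Q)) (cball x r) \<le> \<delta>"
    and y: "y \<in> cball x r" "y \<noteq> x" "W_stationary I J k Q x" "W_stationary I J k Q y" by blast
  then obtain w where "\<forall>z\<in>cball x r. W_stationary I J k Q z \<longrightarrow> z = w" using \<delta> by blast
  moreover have "x \<in> cball x r" using \<open>r > 0\<close> by simp
  ultimately show False using y by metis
qed

text \<open>Split \<open>w\<close> into a component in the span and one orthogonal to it; the latter is orthogonal to all
  \<open>g c\<close>, hence to \<open>w\<close> and so to itself.\<close>

lemma orthogonal_to_kernel_imp_combination: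
  fixes g :: "'c \<Rightarrow> 'a::euclidean_space"
  assumes "finite A" "inj_on g A" and ortho: "\<And>\<eta>. \<forall>c\<in>A. inner (g c) \<eta> = 0 \<Longrightarrow> inner w \<eta> = 0"
  obtains \<nu> where "w = (\<Sum>c\<in>A. \<nu> c *\<^sub>R g c)"
proof -
  obtain a b where a: "a \<in> span (g ` A)" and b: "\<And>v. v \<in> span (g ` A) \<Longrightarrow> inner b v = 0" and w: "w = a + b"
    using orthogonal_subspace_decomp_exists[of "g ` A" w] unfolding Linear_Algebra.orthogonal_def by metis
  have "inner w b = 0"
    using b[OF span_base] by (intro ortho) (metis imageI inner_commute)
  then have "b = 0" using b[OF a] by (simp add: w inner_add_left inner_commute[of a b])
  with a w obtain U where "w = (\<Sum>v\<in>g ` A. U v *\<^sub>R v)"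
    using span_finite[of "g ` A"] \<open>finite A\<close> by auto
  also have "\<dots> = (\<Sum>c\<in>A. U (g c) *\<^sub>R g c)"
    using sum.reindex[OF \<open>inj_on g A\<close>, of "\<lambda>v. U v *\<^sub>R v"] by simp
  finally show thesis by (rule that)
qed

text \<open>If the restricted Hessian is singular, a vector \<open>\<xi>\<close> of its left kernel makes
  \<open>x + s \<xi>\<close> a second W-stationary point of a small perturbation. If a multiplier of a biactive pair
  vanishes, say that of \<open>c0\<close>, then \<open>c0\<close> may be dropped from the constraints. The Karush-Kuhn-Tucker
  operator is surjective by what has been shown, and this yields a direction \<open>\<xi>\<close> tangential to the other constraints
  along which \<open>c0\<close> grows and which the Hessian maps to a combination of the gradients.\<close>

lemma strongly_stable_imp_nondegenerate:
  fixes P :: "('n::finite, 'i, 'j) mpsc"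
  assumes fin: "finite I" "finite J" and P: "C2_mpsc I J k P"
    and J0: "J0 J P x = {}" and stable: "strongly_stable I J k P x" and LICQ: "LICQ I J k P x"
  shows "nondegenerate I J k P x"
proof -
  let ?A = "active I J k P x"
  let ?g = "\<lambda>c. gradient (constraint P c) x"
  have fA: "finite ?A"
    using finite_subset[OF active_subset_labels finite_labels[OF fin]] .
  from stable have "W_stationary I J k P x" by (simp add: strongly_stable_def)
  then obtain lam \<mu> \<sigma>1 \<sigma>2 where feas: "x \<in> feasible_set I J k P"
    and mult: "W_multipliers I J k P x lam \<mu> \<sigma>1 \<sigma>2"
    unfolding W_stationary_def by blast
  define \<Lambda> where "\<Lambda> = case_label lam \<mu> \<sigma>1 \<sigma>2"
  have stat: "gradient (objf P) x = (\<Sum>c\<in>?A. \<Lambda> c *\<^sub>R ?g c)" and supp: "\<forall>c\<in>labels I J k - ?A. \<Lambda> c = 0"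
    using mult W_multipliers_iff[OF fin feas, of \<Lambda> lam \<mu> \<sigma>1 \<sigma>2] by (auto simp: \<Lambda>_def)
  define H where "H = hessian (lagrangian I J k P lam \<mu> \<sigma>1 \<sigma>2) x"
  have H: "H = hessian (objf P) x - (\<Sum>c\<in>?A. \<Lambda> c *\<^sub>R hessian (constraint P c) x)"
    unfolding H_def hessian_lagrangian_active[OF fin P supp[unfolded \<Lambda>_def]] \<Lambda>_def ..
  have EqA: "\<forall>i\<in>I. Eq i \<in> ?A" by (auto simp: active_def)
  have SwA: "\<forall>m\<in>{1..k}. Sw1 m \<in> ?A \<or> Sw2 m \<in> ?A"
    using feas by (auto simp: active_eq[OF feas] feasible_iff)
  have ND4: "nonsingular_on H (tangent_space I J k P x)"
    unfolding nonsingular_on_iff[OF subspace_tangent_space]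
  proof (intro ballI impI, rule ccontr)
    fix \<xi> assume \<xi>: "\<xi> \<in> tangent_space I J k P x" "\<xi> \<noteq> 0"
      and ker: "\<forall>\<eta>\<in>tangent_space I J k P x. inner \<xi> (H *v \<eta>) = 0"
    have ortho: "inner (\<xi> v* H) \<eta> = 0" if "\<forall>c\<in>?A. inner (?g c) \<eta> = 0" for \<eta>
      using ker that by (simp add: tangent_space_eq dot_lmul_matrix)
    have "inj_on ?g ?A" using LICQ by (simp add: LICQ_def)
    obtain \<nu> where "\<xi> v* H = (\<Sum>c\<in>?A. \<nu> c *\<^sub>R ?g c)"
      using orthogonal_to_kernel_imp_combination[OF fA \<open>inj_on ?g ?A\<close> ortho] .
    then have "\<not> strongly_stable I J k P x"
      using \<xi> by (intro not_strongly_stableI[OF fin P feas J0 refl subset_refl EqA SwA stat, of \<xi> \<nu>])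
        (auto simp: H tangent_space_eq)
    with stable show False by contradiction
  qed
  have ND3: "\<sigma>1 m * \<sigma>2 m \<noteq> 0" if m: "m \<in> \<beta>_set k P x" for m
  proof
    assume "\<sigma>1 m * \<sigma>2 m = 0"
    moreover have mA: "Sw1 m \<in> ?A" "Sw2 m \<in> ?A" using m by (auto simp: active_def)
    ultimately obtain c0 where c0: "c0 \<in> ?A" "\<Lambda> c0 = 0" "c0 = Sw1 m \<or> c0 = Sw2 m"
      by (auto simp: \<Lambda>_def)
    obtain lab :: "'n \<Rightarrow> ('i, 'j) label" and S where lab: "bij_betw lab S ?A"
      using LICQ_enumeration[OF fin LICQ] .
    have "c0 \<in> lab ` S" using c0 by (simp only: bij_betw_imp_surj_on[OF lab])
    then obtain p0 where p0: "p0 \<in> S" "lab p0 = c0" by auto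
    \<comment> \<open>Solve the linearized system with right-hand side one at \<open>c0\<close> and zero elsewhere.\<close>
    define T where "T = kkt_op H S (\<lambda>p. ?g (lab p))"
    have "surj T"
      unfolding T_def
      by (intro linear_injective_imp_surjective linear_kkt_op inj_kkt_op_active[OF fin LICQ lab ND4] refl)
    then obtain \<xi> u where "T (\<xi>, u) = (0, axis p0 1)" by (metis surjD surj_pair)
    then have ker: "\<xi> v* H = (\<Sum>p\<in>S. u $ p *\<^sub>R ?g (lab p))"
      and comp: "(if p \<in> S then inner (?g (lab p)) \<xi> else u $ p) = axis p0 1 $ p" for p
      by (simp_all add: T_def kkt_op_def prod_eq_iff Finite_Cartesian_Product.vec_eq_iff cong: if_cong)
    have tan: "inner (?g (lab p)) \<xi> = (if p = p0 then 1 else 0)" if "p \<in> S" for p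
      using comp[of p] that by (simp add: axis_def)
    have "\<xi> \<noteq> 0" using tan[OF p0(1)] by auto
    have "\<xi> v* H = (\<Sum>c\<in>?A. u $ inv_into S lab c *\<^sub>R ?g c)"
      unfolding ker sum.reindex_bij_betw[OF lab, symmetric]
      using bij_betw_inv_into_left[OF lab] by simp
    moreover have "\<forall>c\<in>?A - {c0}. inner (?g c) \<xi> = 0"
    proof
      fix c assume c: "c \<in> ?A - {c0}"
      then have "c \<in> lab ` S" by (simp only: bij_betw_imp_surj_on[OF lab] Diff_iff)
      then show "inner (?g c) \<xi> = 0" using c tan p0 by auto
    qed
    moreover have "\<forall>i\<in>I. Eq i \<in> ?A - {c0}" using EqA c0(3) by auto
    moreover have "\<forall>l\<in>{1..k}. Sw1 l \<in> ?A - {c0} \<or> Sw2 l \<in> ?A - {c0}"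
      using SwA mA c0(3) by (metis DiffI label.inject(3,4) label.distinct(11) singletonD)
    ultimately have "\<not> strongly_stable I J k P x"
      using c0(2) \<open>\<xi> \<noteq> 0\<close>
      by (intro not_strongly_stableI[OF fin P feas J0 refl Diff_subset _ _ stat, of "{c0}" \<xi>]) (auto simp: H)
    with stable show False by contradiction
  qed
  show ?thesis
    unfolding nondegenerate_def
    using feas mult LICQ ND3 ND4 J0 unfolding H_def by blast
qed

theorem corollary4p3:
  fixes I :: "'i set" and J :: "'j set" and k :: nat
    and P :: "('n::finite, 'i, 'j) mpsc" and x :: "real ^ 'n"
  assumes "finite I" and "finite J"
    and "C2_mpsc I J k P"
    and "W_stationary I J k P x"
    and "J0 J P x = {}"
  shows "nondegenerate I J k P x \<longleftrightarrow> strongly_stable I J k P x \<and> LICQ I J k P x"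
proof
  assume nd: "nondegenerate I J k P x"
  then have "LICQ I J k P x" unfolding nondegenerate_def by blast
  with nondegenerate_imp_strongly_stable[OF assms nd]
  show "strongly_stable I J k P x \<and> LICQ I J k P x" ..
next
  assume "strongly_stable I J k P x \<and> LICQ I J k P x"
  then show "nondegenerate I J k P x"
    using strongly_stable_imp_nondegenerate[OF assms(1,2,3,5)] by blast
qed

end
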